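(* Let $a,b,r$ be integers with $r\ge1$ and $b\ge a\ge r+2$, and let $G$ be a connected graph of order $n \geq 2(4b+a+r + 2)(b+r + 2)$ with minimum degree $\delta(G)\ge a+r$. If $\lambda(G) \geq \lambda(F_{n}^{a,b,r})$, then $G$ is fractional $ID$-$[a,b]$-factor-critical (with respect to $r$), unless $G \cong F_{n}^{a,b,r}$.
   Context: All graphs are finite, simple and undirected. $\lambda(G)$ denotes the largest eigenvalue of the adjacency matrix of $G$. $K_m$ is the complete graph on $m$ vertices, $mK_1$ is the edgeless graph on $m$ vertices, $G_1\cup G_2$ is disjoint union, and the join $G_1\vee G_2$ is obtained from $G_1\cup G_2$ by adding all edges between $V(G_1)$ and $V(G_2)$. $F_{n}^{a,b,r}$ is the graph of order $n$ obtained from $rK_1\vee \big(K_{a} \vee ( K_{n-(a+b+r+1)} \cup (b+1)K_1 )\big)$ by adding $a-1$ edges joining one vertex of $V((b+1)K_1)$ to $a-1$ distinct vertices of $V(K_{n-(a+b+r+1)})$. For positive integers $a\le b$, a graph $G$ has a fractional $[a,b]$-factor if there is a function $h: E(G)\to[0,1]$ such that $a\le \sum_{e\ni v} h(e)\le b$ for every $v\in V(G)$ (the sum is over edges incident with $v$). For an integer $r\ge 1$, $G$ is fractional $ID$-$[a,b]$-factor-critical (with respect to $r$) if for every independent set $I$ of $G$ with $|I|=r$, the graph $G-I$ has a fractional $[a,b]$-factor. *)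

theory Defs
  imports "Graph_Theory.Graph_Theory" "Jordan_Normal_Form.Char_Poly"
begin

text \<open>
  Finite simple undirected graphs are symmetric loop-free digraphs without parallel arcs, the
  locale \<^locale>\<open>pair_graph\<close>: every edge is present as a pair of opposite arcs.
\<close>

definition undirected_edges :: "('a, 'b) pre_digraph \<Rightarrow> 'a set set" where
  "undirected_edges G = {{u, v} | u v. (u, v) \<in> arcs_ends G}"

text \<open>In a symmetric digraph without parallel arcs the out-degree is the number of neighbours.\<close>

definition min_degree :: "('a, 'b) pre_digraph \<Rightarrow> nat" where
  "min_degree G = Min (out_degree G ` verts G)"

definition independent_set :: "('a, 'b) pre_digraph \<Rightarrow> 'a set \<Rightarrow> bool" where
  "independent_set G I \<longleftrightarrow> I \<subseteq> verts G \<and> (\<forall>u\<in>I. \<forall>v\<in>I. (u, v) \<notin> arcs_ends G)"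

definition adjacency_matrix :: "('a, 'b) pre_digraph \<Rightarrow> 'a list \<Rightarrow> real mat" where
  "adjacency_matrix G xs = mat (length xs) (length xs)
     (\<lambda>(i, j). if (xs ! i, xs ! j) \<in> arcs_ends G then 1 else 0)"

text \<open>
  The matrix depends on an enumeration of the vertices, its eigenvalues do not: see
  \<open>adjacency_eigenvalue_enum\<close> below.
\<close>

definition adjacency_eigenvalues :: "('a, 'b) pre_digraph \<Rightarrow> real set" where
  "adjacency_eigenvalues G =
     {k. \<exists>xs. distinct xs \<and> set xs = verts G \<and> eigenvalue (adjacency_matrix G xs) k}"

definition largest_eigenvalue :: "('a, 'b) pre_digraph \<Rightarrow> real" where
  "largest_eigenvalue G = Max (adjacency_eigenvalues G)"

definition complete_graph :: "nat \<Rightarrow> nat pair_pre_digraph" where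
  "complete_graph m = \<lparr>pverts = {..<m}, parcs = {(i, j). i < m \<and> j < m \<and> i \<noteq> j}\<rparr>"

definition edgeless_graph :: "nat \<Rightarrow> nat pair_pre_digraph" where
  "edgeless_graph m = \<lparr>pverts = {..<m}, parcs = {}\<rparr>"

definition disjoint_union ::
    "'a pair_pre_digraph \<Rightarrow> 'b pair_pre_digraph \<Rightarrow> ('a + 'b) pair_pre_digraph" where
  "disjoint_union G H = \<lparr>pverts = pverts G <+> pverts H,
     parcs = {(Inl u, Inl v) | u v. (u, v) \<in> parcs G} \<union> {(Inr u, Inr v) | u v. (u, v) \<in> parcs H}\<rparr>"

definition graph_join ::
    "'a pair_pre_digraph \<Rightarrow> 'b pair_pre_digraph \<Rightarrow> ('a + 'b) pair_pre_digraph" where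
  "graph_join G H = \<lparr>pverts = pverts (disjoint_union G H),
     parcs = parcs (disjoint_union G H)
       \<union> {(Inl u, Inr v) | u v. u \<in> pverts G \<and> v \<in> pverts H}
       \<union> {(Inr v, Inl u) | u v. u \<in> pverts G \<and> v \<in> pverts H}\<rparr>"

text \<open>
  The summands of the vertex type are, from left to right, the vertices of $rK_1$, $K_a$,
  $K_{n-(a+b+r+1)}$ and $(b+1)K_1$. The additional edges join vertex 0 of $(b+1)K_1$ to the
  vertices $0,\ldots,a-2$ of $K_{n-(a+b+r+1)}$; another choice gives an isomorphic graph.
  The subtractions are truncated, so the graph is the intended one for $a \ge 1$ and
  $n \ge 2a+b+r$.
\<close>

definition F_graph :: "nat \<Rightarrow> nat \<Rightarrow> nat \<Rightarrow> nat \<Rightarrow> (nat + nat + nat + nat) pair_pre_digraph" where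
  "F_graph n a b r =
     (let H = graph_join (edgeless_graph r)
                (graph_join (complete_graph a)
                  (disjoint_union (complete_graph (n - (a + b + r + 1))) (edgeless_graph (b + 1))));
          x = Inr (Inr (Inr 0));
          y = (\<lambda>i. Inr (Inr (Inl i)))
      in H\<lparr>parcs := parcs H \<union> {(x, y i) | i. i < a - 1} \<union> {(y i, x) | i. i < a - 1}\<rparr>)"

definition has_fractional_factor :: "nat \<Rightarrow> nat \<Rightarrow> ('a, 'b) pre_digraph \<Rightarrow> bool" where
  "has_fractional_factor a b G \<longleftrightarrow>
     (\<exists>h :: 'a set \<Rightarrow> real.
        (\<forall>e \<in> undirected_edges G. 0 \<le> h e \<and> h e \<le> 1) \<and>
        (\<forall>v \<in> verts G. real a \<le> (\<Sum>e \<in> {e \<in> undirected_edges G. v \<in> e}. h e) \<and>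
                       (\<Sum>e \<in> {e \<in> undirected_edges G. v \<in> e}. h e) \<le> real b))"

definition fractional_ID_factor_critical ::
    "nat \<Rightarrow> nat \<Rightarrow> nat \<Rightarrow> ('a, 'b) pre_digraph \<Rightarrow> bool" where
  "fractional_ID_factor_critical a b r G \<longleftrightarrow>
     (\<forall>I. independent_set G I \<and> card I = r \<longrightarrow> has_fractional_factor a b (G \<restriction> (verts G - I)))"

lemma eigenvalue_adjacency_matrix_iff:
  assumes xs: "distinct xs" "set xs = verts G"
  shows "eigenvalue (adjacency_matrix G xs) k \<longleftrightarrow>
    (\<exists>f. (\<exists>v\<in>verts G. f v \<noteq> 0) \<and>
         (\<forall>v\<in>verts G. (\<Sum>u\<in>verts G. if (v, u) \<in> arcs_ends G then f u else 0) = k * f v))"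
    (is "?L \<longleftrightarrow> (\<exists>f. ?R f)")
proof -
  let ?n = "length xs"
  have sum_xs: "(\<Sum>u\<in>verts G. g u) = (\<Sum>i<?n. g (xs ! i))" for g :: "_ \<Rightarrow> real"
    using sum.reindex_bij_betw[OF bij_betw_nth[OF xs(1) refl refl], of g] xs by (simp add: atLeast0LessThan)
  have all_xs: "(\<forall>v\<in>verts G. P v) \<longleftrightarrow> (\<forall>i<?n. P (xs ! i))" for P
    using xs(2) by (metis in_set_conv_nth)
  have mult: "(adjacency_matrix G xs *\<^sub>v w) $ i =
      (\<Sum>j<?n. if (xs ! i, xs ! j) \<in> arcs_ends G then w $ j else 0)"
    if "dim_vec w = ?n" "i < ?n" for w i
    using that unfolding adjacency_matrix_def
    by (auto simp: scalar_prod_def atLeast0LessThan intro!: sum.cong)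
  have dims: "dim_row (adjacency_matrix G xs) = ?n"
    by (simp add: adjacency_matrix_def)
  have eigvec: "eigenvector (adjacency_matrix G xs) w k \<longleftrightarrow>
      dim_vec w = ?n \<and> (\<exists>i<?n. w $ i \<noteq> 0) \<and>
      (\<forall>i<?n. (\<Sum>j<?n. if (xs ! i, xs ! j) \<in> arcs_ends G then w $ j else 0) = k * w $ i)"
    for w
  proof (cases "dim_vec w = ?n")
    case True
    have nz: "w \<noteq> 0\<^sub>v ?n \<longleftrightarrow> (\<exists>i<?n. w $ i \<noteq> 0)"
    proof
      assume "w \<noteq> 0\<^sub>v ?n"
      then show "\<exists>i<?n. w $ i \<noteq> 0"
        using True by (metis eq_vecI index_zero_vec)
    next
      assume "\<exists>i<?n. w $ i \<noteq> 0"
      then show "w \<noteq> 0\<^sub>v ?n" by (metis index_zero_vec(1))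
    qed
    have eq: "adjacency_matrix G xs *\<^sub>v w = k \<cdot>\<^sub>v w \<longleftrightarrow>
        (\<forall>i<?n. (adjacency_matrix G xs *\<^sub>v w) $ i = k * w $ i)" (is "?M = _ \<longleftrightarrow> _")
    proof
      assume "?M = k \<cdot>\<^sub>v w"
      then show "\<forall>i<?n. ?M $ i = k * w $ i" using True by (metis index_smult_vec(1))
    next
      assume "\<forall>i<?n. ?M $ i = k * w $ i"
      then show "?M = k \<cdot>\<^sub>v w"
        using True dims by (intro eq_vecI) (simp_all del: index_mult_mat_vec)
    qed
    have entries: "(\<forall>i<?n. (adjacency_matrix G xs *\<^sub>v w) $ i = k * w $ i) \<longleftrightarrow>
        (\<forall>i<?n. (\<Sum>j<?n. if (xs ! i, xs ! j) \<in> arcs_ends G then w $ j else 0) = k * w $ i)"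
      by (rule all_cong) (simp only: mult[OF True])
    have carrier: "w \<in> carrier_vec ?n" using True by (rule carrier_vecI)
    show ?thesis
      unfolding eigenvector_def dims nz eq entries using carrier True by blast
  next
    case False
    then show ?thesis using dims by (auto simp: eigenvector_def)
  qed
  show ?thesis
  proof
    assume ?L
    then obtain w where w: "eigenvector (adjacency_matrix G xs) w k"
      unfolding eigenvalue_def by blast
    define f where "f v = w $ (the_inv_into {..<?n} ((!) xs) v)" for v
    have f: "f (xs ! i) = w $ i" if "i < ?n" for i
    proof -
      have "inj_on ((!) xs) {..<?n}"
        using xs(1) by (auto simp: inj_on_def nth_eq_iff_index_eq)
      then show ?thesis using that by (simp add: f_def the_inv_into_f_f)
    qed
    have sums: "(\<Sum>j<?n. if (xs ! i, xs ! j) \<in> arcs_ends G then f (xs ! j) else 0) =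
        (\<Sum>j<?n. if (xs ! i, xs ! j) \<in> arcs_ends G then w $ j else 0)" for i
      by (rule sum.cong) (auto simp: f)
    from w obtain i where "i < ?n" "w $ i \<noteq> 0" unfolding eigvec by blast
    then have "xs ! i \<in> verts G" "f (xs ! i) \<noteq> 0" using xs(2) f by auto
    moreover have "\<forall>v\<in>verts G. (\<Sum>u\<in>verts G. if (v, u) \<in> arcs_ends G then f u else 0) = k * f v"
      unfolding all_xs sum_xs sums using w f unfolding eigvec by simp
    ultimately have "?R f" by blast
    then show "\<exists>f. ?R f" by (rule exI[of _ f])
  next
    assume "\<exists>f. ?R f"
    then obtain f where f: "?R f" ..
    let ?w = "vec ?n (\<lambda>i. f (xs ! i))"
    have sums: "(\<Sum>j<?n. if (xs ! i, xs ! j) \<in> arcs_ends G then ?w $ j else 0) =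
        (\<Sum>j<?n. if (xs ! i, xs ! j) \<in> arcs_ends G then f (xs ! j) else 0)" for i
      by (rule sum.cong) auto
    from f obtain v where "v \<in> set xs" "f v \<noteq> 0" using xs(2) by blast
    then have "\<exists>i<?n. ?w $ i \<noteq> 0" by (metis in_set_conv_nth index_vec)
    moreover have "\<forall>i<?n. (\<Sum>j<?n. if (xs ! i, xs ! j) \<in> arcs_ends G then f (xs ! j) else 0)
        = k * f (xs ! i)"
      using f unfolding all_xs sum_xs by blast
    ultimately have "eigenvector (adjacency_matrix G xs) ?w k"
      unfolding eigvec sums by simp
    then show ?L unfolding eigenvalue_def by blast
  qed
qed

lemma adjacency_eigenvalue_enum:
  assumes "distinct xs" "set xs = verts G"
  shows "k \<in> adjacency_eigenvalues G \<longleftrightarrow> eigenvalue (adjacency_matrix G xs) k"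
  using assms eigenvalue_adjacency_matrix_iff[of _ G k] unfolding adjacency_eigenvalues_def
  by blast

lemma complete_digraph_complete_graph: "K\<^bsub>m\<^esub> (with_proj (complete_graph m))"
  by (auto simp: complete_digraph_pair_def complete_graph_def)

lemma pair_graph_F_graph:
  assumes "1 \<le> a" "2 * a + b + r \<le> n"
  shows "pair_graph (F_graph n a b r)"
proof
  let ?F = "F_graph n a b r"
  show fin: "finite (pverts ?F)"
    by (auto simp: F_graph_def graph_join_def disjoint_union_def edgeless_graph_def
        complete_graph_def Let_def)
  have sub: "parcs ?F \<subseteq> pverts ?F \<times> pverts ?F"
    using assms by (auto simp: F_graph_def graph_join_def disjoint_union_def edgeless_graph_def
        complete_graph_def Let_def)
  then show "finite (parcs ?F)" using fin by (meson finite_SigmaI finite_subset)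
  show "fst e \<in> pverts ?F" "snd e \<in> pverts ?F" if "e \<in> parcs ?F" for e
    using sub that by auto
  show "fst e \<noteq> snd e" if "e \<in> parcs ?F" for e
    using that by (auto simp: F_graph_def graph_join_def disjoint_union_def edgeless_graph_def
        complete_graph_def Let_def)
  show "symmetric ?F"
    unfolding symmetric_def
    by (rule symI) (auto simp: F_graph_def graph_join_def disjoint_union_def edgeless_graph_def
        complete_graph_def Let_def)
qed

lemma card_F_graph:
  assumes "a + b + r + 1 \<le> n"
  shows "card (pverts (F_graph n a b r)) = n"
  using assms by (simp add: F_graph_def graph_join_def disjoint_union_def edgeless_graph_def
      complete_graph_def Let_def card_Plus)

end

theory Submission
  imports Defs "HOL-Analysis.Function_Topology"
begin

text \<open>
  If \<open>G - I\<close> has no fractional factor, minimizing the squared distance of the vertex sums from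
  \<open>[a, b]\<close> yields disjoint sets \<open>S\<close>, \<open>T\<close> with \<open>b |S| + (\<Sum>v\<in>T. d v) < a |T|\<close>, where \<open>d\<close> is the degree
  in \<open>G - I - S\<close>, and the minimum degree forces \<open>|T| > b\<close>. Let \<open>x\<close> be a nonnegative eigenvector for the
  largest eigenvalue \<open>k\<close> with maximal entry 1. The entries of \<open>x\<close> sum to at least \<open>k + 1\<close>, and those
  on \<open>T\<close> are at most the degree divided by \<open>k\<close>; if \<open>|T| \<ge> b + 2\<close>, this makes \<open>k\<close> smaller than the
  eigenvalue of \<open>F\<close>, which is nearly \<open>n - b - 2\<close>. If \<open>|T| = b + 1\<close>, complete all arcs outside \<open>T\<close>
  (except inside \<open>I\<close>). Then either \<open>G\<close> is a subgraph of \<open>F\<close>, so \<open>G = F\<close> by strict monotonicity, or the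
  excess degrees on \<open>T\<close> are not concentrated at one vertex, and pairing the eigenvectors of the two
  graphs shows that concentrating them strictly increases the eigenvalue.
\<close>

section \<open>The largest eigenvalue\<close>

text \<open>In \<open>G - I\<close> every vertex keeps degree at least \<open>a\<close>. If
  \<open>|T| = b + 1\<close>, the obstruction leaves a total excess over \<open>a\<close> of at most
  \<open>a - 1\<close> on \<open>T\<close>; this is where the \<open>a - 1\<close> additional edges
  of \<open>F\<close> come from. The obstacle is the comparison of two ways to spread this excess.
  Pairing \<open>x\<close> with itself does not decide it: all entries of \<open>x\<close> on
  \<open>T\<close> may be equal, so moving an arc to \<open>w\<close> may gain nothing, while the
  clique entry at its other end may get slightly smaller. The eigenvector of \<open>F\<close> has a
  definite gap between \<open>w\<close> and the rest of \<open>T\<close>, whence the mixed pairing.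
  The gap beats the losses because \<open>a - 1 \<ge> 2\<close>, which is where
  \<open>r + 2 \<le> a\<close> enters. The order bound makes the eigenvalue at least the total
  degree of \<open>T\<close>. Hence all of \<open>T\<close> carries weight at most 1, and every
  clique entry is within \<open>1 / (k + 1)\<close> of 1.\<close>

text \<open>Tychonoff on the whole index type. The type may be infinite, so later uses pin the
  coordinates outside a finite set to 0.\<close>

lemma compact_function_box:
  fixes K :: "'i \<Rightarrow> real set"
  assumes "\<And>i. compact (K i)"
  shows "compact {f. \<forall>i. f i \<in> K i}"
proof -
  have "compactin (product_topology (\<lambda>_. euclidean) UNIV) (PiE UNIV K)"
    using assms by (simp add: compactin_PiE)
  then show ?thesis
    by (simp add: euclidean_product_topology PiE_def Pi_def)
qed

text \<open>The bilinear form of the adjacency matrix, with each edge counted in both directions. It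
  takes two vectors so that eigenvectors of different graphs can be paired.\<close>

definition adjacency_form :: "('a \<times> 'a) set \<Rightarrow> ('a \<Rightarrow> real) \<Rightarrow> ('a \<Rightarrow> real) \<Rightarrow> real" where
  "adjacency_form E x y = (\<Sum>(u, v)\<in>E. x u * y v)"

definition simple_graph :: "'a set \<Rightarrow> ('a \<times> 'a) set \<Rightarrow> bool" where
  "simple_graph V E \<longleftrightarrow> finite V \<and> E \<subseteq> V \<times> V \<and> sym E \<and> irrefl E"

definition index :: "'a set \<Rightarrow> ('a \<times> 'a) set \<Rightarrow> real" where
  "index V E = largest_eigenvalue (with_proj \<lparr>pverts = V, parcs = E\<rparr>)"

lemma simple_graph_finite_arcs: "simple_graph V E \<Longrightarrow> finite E"
  unfolding simple_graph_def by (meson finite_SigmaI finite_subset)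

lemma simple_graph_finite_nbrs: "simple_graph V E \<Longrightarrow> finite (E `` {v})"
  unfolding simple_graph_def by (metis Image_singleton finite_Image finite_SigmaI finite_subset)

lemma simple_graph_nbrs_subset: "simple_graph V E \<Longrightarrow> E `` {v} \<subseteq> V"
  unfolding simple_graph_def by auto

lemma adjacency_form_nbrs:
  assumes "simple_graph V E"
  shows "adjacency_form E x y = (\<Sum>u\<in>V. x u * (\<Sum>v\<in>E `` {u}. y v))"
proof -
  have "E = (SIGMA u:V. E `` {u})" using assms unfolding simple_graph_def by auto
  then have "adjacency_form E x y = (\<Sum>(u, v)\<in>(SIGMA u:V. E `` {u}). x u * y v)"
    unfolding adjacency_form_def by simp
  also have "\<dots> = (\<Sum>u\<in>V. \<Sum>v\<in>E `` {u}. x u * y v)"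
    using assms simple_graph_finite_nbrs[OF assms]
    by (subst sum.Sigma) (auto simp: simple_graph_def)
  finally show ?thesis by (simp add: sum_distrib_left)
qed

lemma adjacency_form_commute:
  assumes "sym E"
  shows "adjacency_form E x y = adjacency_form E y x"
  unfolding adjacency_form_def
  by (rule sum.reindex_bij_witness[of _ prod.swap prod.swap])
    (use assms in \<open>auto simp: sym_def\<close>)

lemma adjacency_form_add:
  "adjacency_form E (\<lambda>v. x v + y v) z = adjacency_form E x z + adjacency_form E y z"
  "adjacency_form E z (\<lambda>v. x v + y v) = adjacency_form E z x + adjacency_form E z y"
  by (auto simp: adjacency_form_def sum.distrib[symmetric] algebra_simps intro!: sum.cong)

lemma adjacency_form_scale:
  "adjacency_form E (\<lambda>v. c * x v) z = c * adjacency_form E x z"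
  "adjacency_form E z (\<lambda>v. c * x v) = c * adjacency_form E z x"
  by (auto simp: adjacency_form_def sum_distrib_left intro!: sum.cong)

lemma adjacency_form_eigen:
  assumes "simple_graph V E" "\<And>v. v \<in> V \<Longrightarrow> (\<Sum>u\<in>E `` {v}. y u) = k * y v"
  shows "adjacency_form E x y = k * (\<Sum>v\<in>V. x v * y v)"
  unfolding adjacency_form_nbrs[OF assms(1)]
  using assms(2) by (simp add: sum_distrib_left algebra_simps)

text \<open>Perron's argument by compactness: a maximizer of the quadratic form on the unit sphere
  can be made nonnegative, and stationarity in each coordinate direction is the eigenvalue
  equation.\<close>

lemma Rayleigh_maximizer:
  assumes G: "simple_graph V E" and "V \<noteq> {}"
  shows "\<exists>x M. (\<forall>v\<in>V. 0 \<le> x v) \<and> (\<exists>v\<in>V. x v \<noteq> 0)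
    \<and> (\<forall>v\<in>V. (\<Sum>u\<in>E `` {v}. x u) = M * x v)
    \<and> (\<forall>f. adjacency_form E f f \<le> M * (\<Sum>v\<in>V. (f v)\<^sup>2))"
proof -
  have fin: "finite V" "E \<subseteq> V \<times> V" "sym E" and finE: "finite E"
    using G simple_graph_finite_arcs[OF G] unfolding simple_graph_def by auto
  have coord: "continuous_on UNIV (\<lambda>f::'a \<Rightarrow> real. f v)" for v
    by (rule continuous_on_product_coordinates)
  \<comment> \<open>The sphere alone is not compact in the product topology, since coordinates
    outside \<open>V\<close> would be free; the box confines them to 0.\<close>
  define K where "K = {f :: 'a \<Rightarrow> real. \<forall>v. f v \<in> (if v \<in> V then {-1..1} else {0})}
     \<inter> {f. (\<Sum>v\<in>V. (f v)\<^sup>2) = 1}"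
  have "compact K" unfolding K_def
    by (intro compact_Int_closed compact_function_box closed_Collect_eq)
       (auto intro!: continuous_intros coord)
  moreover obtain v0 where v0: "v0 \<in> V" using \<open>V \<noteq> {}\<close> by auto
  then have "(\<lambda>v. if v = v0 then 1 else 0) \<in> K"
    unfolding K_def using fin by (auto simp: if_distrib[of "\<lambda>x. x^2"] cong: if_cong)
  then have "K \<noteq> {}" by auto
  moreover have "continuous_on K (\<lambda>f. adjacency_form E f f)"
    unfolding adjacency_form_def case_prod_beta
    by (intro continuous_intros continuous_on_subset[OF coord]) auto
  ultimately obtain f0 where f0: "f0 \<in> K" and max: "\<And>f. f \<in> K \<Longrightarrow> adjacency_form E f f \<le> adjacency_form E f0 f0"
    using continuous_attains_sup[of K "\<lambda>f. adjacency_form E f f"] by blast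
  define M where "M = adjacency_form E f0 f0"
  have ray: "adjacency_form E f f \<le> M * (\<Sum>v\<in>V. (f v)\<^sup>2)" for f
  proof (cases "(\<Sum>v\<in>V. (f v)\<^sup>2) = 0")
    case True
    then have "\<And>v. v \<in> V \<Longrightarrow> f v = 0" using fin by (simp add: sum_nonneg_eq_0_iff)
    then have "adjacency_form E f f = 0" unfolding adjacency_form_def using fin by (intro sum.neutral) auto
    then show ?thesis using True by simp
  next
    case False
    define s where "s = (\<Sum>v\<in>V. (f v)\<^sup>2)"
    have s: "s > 0" using False unfolding s_def by (metis less_eq_real_def sum_nonneg zero_le_power2)
    define g where "g v = (if v \<in> V then f v / sqrt s else 0)" for v
    have g2: "(\<Sum>v\<in>V. (g v)\<^sup>2) = 1"
      using s by (simp add: g_def power_divide sum_divide_distrib[symmetric] s_def[symmetric])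
    have g1: "\<bar>g v\<bar> \<le> 1" if "v \<in> V" for v
      using member_le_sum[of v V "\<lambda>v. (g v)\<^sup>2"] that fin g2 by (simp add: abs_square_le_1)
    then have "g \<in> K" unfolding K_def using g2 abs_le_D1[OF g1] abs_le_D2[OF g1]
      by (force simp: g_def[of v for v] minus_le_iff)
    then have "adjacency_form E g g \<le> M" using max M_def by simp
    moreover have "adjacency_form E g g = adjacency_form E f f / s"
      unfolding adjacency_form_def sum_divide_distrib
      by (rule sum.cong) (use fin s in \<open>auto simp: g_def\<close>)
    ultimately show ?thesis using s by (simp add: s_def[symmetric] field_simps)
  qed
  \<comment> \<open>All arcs have weight 1, so passing to absolute values cannot decrease the
    form.\<close>
  define x where "x v = \<bar>f0 v\<bar>" for v
  have x2: "(\<Sum>v\<in>V. (x v)\<^sup>2) = 1" using f0 by (simp add: x_def K_def)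
  have "M \<le> adjacency_form E x x"
    unfolding M_def adjacency_form_def x_def
    by (rule sum_mono) (auto simp: abs_mult[symmetric])
  then have xM: "adjacency_form E x x = M" using ray[of x] x2 by simp
  have eig: "(\<Sum>u\<in>E `` {v}. x u) = M * x v" if v: "v \<in> V" for v
  proof -
    define d where "d = (\<Sum>u\<in>E `` {v}. x u) - M * x v"
    define g :: "'a \<Rightarrow> real" where "g u = (if u = v then 1 else 0)" for u
    have gy: "adjacency_form E g y = (\<Sum>u\<in>E `` {v}. y u)" for y
      unfolding adjacency_form_nbrs[OF G] g_def using fin v
      by (simp add: if_distrib[of "\<lambda>a. a * _"] cong: if_cong)
    have "v \<notin> E `` {v}" using G unfolding simple_graph_def irrefl_def by auto
    then have gg: "adjacency_form E g g = 0" unfolding gy by (auto simp: g_def intro!: sum.neutral)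
    have gx: "(\<Sum>u\<in>V. x u * g u) = x v" "(\<Sum>u\<in>V. (g u)\<^sup>2) = 1"
      unfolding g_def using fin v by (auto simp: if_distrib[of "\<lambda>a. _ * a"] if_distrib[of "\<lambda>x. x^2"] cong: if_cong)
    have ineq: "2 * t * d \<le> t\<^sup>2 * M" for t
    proof -
      have "adjacency_form E (\<lambda>u. x u + t * g u) (\<lambda>u. x u + t * g u)
          = M + 2 * t * (\<Sum>u\<in>E `` {v}. x u)"
        using adjacency_form_commute[OF fin(3), of x g] xM gg
        by (simp add: adjacency_form_add adjacency_form_scale gy)
      moreover have "(\<Sum>u\<in>V. (x u + t * g u)\<^sup>2)
          = (\<Sum>u\<in>V. (x u)\<^sup>2) + 2 * t * (\<Sum>u\<in>V. x u * g u) + t\<^sup>2 * (\<Sum>u\<in>V. (g u)\<^sup>2)"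
        by (simp add: sum_distrib_left sum.distrib[symmetric] power2_eq_square algebra_simps)
      ultimately show ?thesis
        using ray[of "\<lambda>u. x u + t * g u"] x2 gx by (simp add: d_def algebra_simps)
    qed
    \<comment> \<open>The inequality is linear in \<open>t\<close> on the left and quadratic on the
      right, so a small \<open>t\<close> with the sign of \<open>d\<close> refutes
      \<open>d \<noteq> 0\<close>. For \<open>M > 0\<close> the witness is \<open>d / M\<close>;
      otherwise the right side is at most 0 and \<open>t = d\<close> suffices.\<close>
    have "d\<^sup>2 \<le> 0"
    proof (cases "M > 0")
      case True
      then show ?thesis using ineq[of "d / M"] by (simp add: field_simps power2_eq_square)
    next
      case False
      have "2 * d\<^sup>2 \<le> d\<^sup>2 * M" using ineq[of d] by (simp add: power2_eq_square)
      also have "\<dots> \<le> 0" using False by (simp add: mult_nonneg_nonpos)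
      finally show ?thesis by simp
    qed
    then show ?thesis by (simp add: d_def)
  qed
  have "\<exists>v\<in>V. x v \<noteq> 0" using x2 by (metis (no_types, lifting) power_zero_numeral sum.neutral zero_neq_one)
  then show ?thesis using eig ray by (intro exI[of _ x] exI[of _ M]) (auto simp: x_def)
qed

text \<open>The Rayleigh maximum is an eigenvalue, and it bounds every other one because an
  eigenvector for \<open>k\<close> has Rayleigh quotient \<open>k\<close>.\<close>

lemma index_Rayleigh:
  assumes G: "simple_graph V E" and ne: "V \<noteq> {}"
  obtains x where "\<And>v. v \<in> V \<Longrightarrow> 0 \<le> x v" "\<exists>v\<in>V. x v \<noteq> 0"
    "\<And>v. v \<in> V \<Longrightarrow> (\<Sum>u\<in>E `` {v}. x u) = index V E * x v"
    "\<And>f. adjacency_form E f f \<le> index V E * (\<Sum>v\<in>V. (f v)\<^sup>2)"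
proof -
  let ?G = "with_proj \<lparr>pverts = V, parcs = E\<rparr>"
  have fin: "finite V" "E \<subseteq> V \<times> V" using G unfolding simple_graph_def by auto
  obtain xs where xs: "distinct xs" "set xs = verts ?G"
    using finite_distinct_list[OF fin(1)] by auto
  have nbr: "(\<Sum>u\<in>verts ?G. if (v, u) \<in> arcs_ends ?G then f u else 0) = (\<Sum>u\<in>E `` {v}. f u)"
    for v and f :: "'a \<Rightarrow> real"
    using fin by (auto simp: sum.If_cases Image_singleton intro!: sum.cong)
  have iff: "k \<in> adjacency_eigenvalues ?G \<longleftrightarrow>
    (\<exists>f. (\<exists>v\<in>V. f v \<noteq> 0) \<and> (\<forall>v\<in>V. (\<Sum>u\<in>E `` {v}. f u) = k * f v))" for k
    unfolding adjacency_eigenvalue_enum[OF xs] eigenvalue_adjacency_matrix_iff[OF xs] nbr by simp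
  let ?A = "adjacency_matrix ?G xs"
  have A: "?A \<in> carrier_mat (length xs) (length xs)" unfolding adjacency_matrix_def by simp
  \<comment> \<open>\<open>Max\<close> is only meaningful on a finite set; the eigenvalues are roots
    of a nonzero polynomial.\<close>
  have "finite {k. poly (char_poly ?A) k = 0}"
    using degree_monic_char_poly[OF A] by (intro poly_roots_finite) auto
  then have finS: "finite (adjacency_eigenvalues ?G)"
    by (rule rev_finite_subset)
      (auto simp: adjacency_eigenvalue_enum[OF xs] eigenvalue_root_char_poly[OF A])
  obtain x M where x: "\<forall>v\<in>V. 0 \<le> x v" "\<exists>v\<in>V. x v \<noteq> 0"
    "\<forall>v\<in>V. (\<Sum>u\<in>E `` {v}. x u) = M * x v"
    and ray: "\<And>f. adjacency_form E f f \<le> M * (\<Sum>v\<in>V. (f v)\<^sup>2)"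
    using Rayleigh_maximizer[OF G ne] by blast
  have "index V E = M"
    unfolding index_def largest_eigenvalue_def
  proof (rule Max_eqI[OF finS])
    show "M \<in> adjacency_eigenvalues ?G" unfolding iff using x by blast
    fix k assume "k \<in> adjacency_eigenvalues ?G"
    then obtain f where f: "\<exists>v\<in>V. f v \<noteq> 0" "\<forall>v\<in>V. (\<Sum>u\<in>E `` {v}. f u) = k * f v"
      unfolding iff by blast
    have "adjacency_form E f f = k * (\<Sum>v\<in>V. (f v)\<^sup>2)"
      using adjacency_form_eigen[OF G, of f k f] f by (simp add: power2_eq_square)
    moreover have "(\<Sum>v\<in>V. (f v)\<^sup>2) > 0"
      using f fin by (metis (mono_tags, lifting) sum_pos2 zero_le_power2 zero_less_power2)
    ultimately show "k \<le> M" using ray[of f] by simp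
  qed
  then show ?thesis using that[of x] x ray by auto
qed

lemma index_mono:
  assumes G: "simple_graph V E" and G': "simple_graph V E'" and "E \<subseteq> E'" "V \<noteq> {}"
  shows "index V E \<le> index V E'"
proof -
  obtain x where x: "\<And>v. v \<in> V \<Longrightarrow> 0 \<le> x v" "\<exists>v\<in>V. x v \<noteq> 0"
    "\<And>v. v \<in> V \<Longrightarrow> (\<Sum>u\<in>E `` {v}. x u) = index V E * x v"
    using index_Rayleigh[OF G \<open>V \<noteq> {}\<close>] by metis
  have fin: "finite V" "E' \<subseteq> V \<times> V" using G' unfolding simple_graph_def by auto
  have "index V E * (\<Sum>v\<in>V. (x v)\<^sup>2) = adjacency_form E x x"
    using adjacency_form_eigen[OF G x(3)] by (simp add: power2_eq_square)
  also have "\<dots> \<le> adjacency_form E' x x" unfolding adjacency_form_def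
    using x(1) fin \<open>E \<subseteq> E'\<close> simple_graph_finite_arcs[OF G'] by (intro sum_mono2) auto
  also have "\<dots> \<le> index V E' * (\<Sum>v\<in>V. (x v)\<^sup>2)"
    using index_Rayleigh[OF G' \<open>V \<noteq> {}\<close>] by metis
  finally have "index V E * (\<Sum>v\<in>V. (x v)\<^sup>2) \<le> index V E' * (\<Sum>v\<in>V. (x v)\<^sup>2)" .
  moreover have "(\<Sum>v\<in>V. (x v)\<^sup>2) > 0"
    using x fin by (metis (mono_tags, lifting) sum_pos2 zero_le_power2 zero_less_power2)
  ultimately show ?thesis by simp
qed

text \<open>At a zero entry the neighbouring entries are nonnegative with sum 0, so zeros spread
  along arcs through the whole graph.\<close>

lemma eigenvector_positive:
  assumes G: "simple_graph V E" and conn: "\<And>u v. u \<in> V \<Longrightarrow> v \<in> V \<Longrightarrow> (u, v) \<in> E\<^sup>*"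
    and x: "\<And>v. v \<in> V \<Longrightarrow> 0 \<le> x v" "\<exists>v\<in>V. x v \<noteq> 0"
    "\<And>v. v \<in> V \<Longrightarrow> (\<Sum>u\<in>E `` {v}. x u) = k * (x v :: real)"
    and v: "v \<in> V"
  shows "0 < x v"
proof (rule ccontr)
  assume "\<not> 0 < x v"
  then have v0: "x v = 0" using x(1)[OF v] by simp
  have sub: "E \<subseteq> V \<times> V" using G unfolding simple_graph_def by auto
  have "x u = 0" if "(v, u) \<in> E\<^sup>*" for u
    using that
  proof (induction rule: rtrancl_induct)
    case base
    show ?case by (fact v0)
  next
    case (step y z)
    then have "y \<in> V" using sub by auto
    then have "(\<Sum>u\<in>E `` {y}. x u) = 0" using x(3) step by simp
    then have "\<forall>u\<in>E `` {y}. x u = 0"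
      using simple_graph_finite_nbrs[OF G] x(1) sub by (subst (asm) sum_nonneg_eq_0_iff) auto
    then show ?case using step by auto
  qed
  then show False using conn[OF v] x(2) by blast
qed

text \<open>Connectedness of the smaller graph makes its eigenvector positive, so any additional arc
  strictly raises the form on that vector.\<close>

lemma index_strict_mono:
  assumes G: "simple_graph V E" and G': "simple_graph V E'" and "E \<subseteq> E'" "V \<noteq> {}"
    and conn: "\<And>u v. u \<in> V \<Longrightarrow> v \<in> V \<Longrightarrow> (u, v) \<in> E\<^sup>*"
    and le: "index V E' \<le> index V E"
  shows "E = E'"
proof (rule ccontr)
  assume "E \<noteq> E'"
  then obtain p q where pq: "(p, q) \<in> E' - E" using \<open>E \<subseteq> E'\<close> by auto
  obtain x where x: "\<And>v. v \<in> V \<Longrightarrow> 0 \<le> x v" "\<exists>v\<in>V. x v \<noteq> 0"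
    "\<And>v. v \<in> V \<Longrightarrow> (\<Sum>u\<in>E `` {v}. x u) = index V E * x v"
    using index_Rayleigh[OF G \<open>V \<noteq> {}\<close>] by metis
  have pos: "0 < x v" if "v \<in> V" for v
    using eigenvector_positive[OF G conn x that] .
  have fin: "finite V" "E' \<subseteq> V \<times> V" using G' unfolding simple_graph_def by auto
  have "index V E * (\<Sum>v\<in>V. (x v)\<^sup>2) = adjacency_form E x x"
    using adjacency_form_eigen[OF G x(3)] by (simp add: power2_eq_square)
  also have "\<dots> < adjacency_form E' x x" unfolding adjacency_form_def
    by (rule sum_strict_mono2[OF simple_graph_finite_arcs[OF G'] \<open>E \<subseteq> E'\<close> pq])
      (use pos x(1) pq fin in auto)
  also have "\<dots> \<le> index V E' * (\<Sum>v\<in>V. (x v)\<^sup>2)"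
    using index_Rayleigh[OF G' \<open>V \<noteq> {}\<close>] by metis
  also have "\<dots> \<le> index V E * (\<Sum>v\<in>V. (x v)\<^sup>2)"
    using le by (intro mult_right_mono sum_nonneg) auto
  finally show False by simp
qed

section \<open>Fractional factors\<close>

text \<open>The deficient vertices \<open>T\<close> and the overloaded vertices \<open>S\<close> of an assignment minimizing the
  squared distance of the vertex sums from \<open>[a, b]\<close>, cut at a common level \<open>c > 0\<close>: by optimality,
  edges from \<open>T\<close> that avoid \<open>S\<close> carry 1 and edges from \<open>S\<close> that avoid \<open>T\<close> carry 0.\<close>

lemma no_fractional_factor_obstruction:
  assumes G: "simple_graph (verts H) (arcs_ends H)" and "a \<le> b"
    and no: "\<not> has_fractional_factor a b H"
  obtains S T where "S \<subseteq> verts H" "T \<subseteq> verts H" "S \<inter> T = {}"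
    "b * card S + (\<Sum>v\<in>T. card (arcs_ends H `` {v} - S)) < a * card T"
proof -
  define V E U where "V = verts H" and "E = arcs_ends H" and "U = undirected_edges H"
  have G: "simple_graph V E" using G by (simp add: V_def E_def)
  have fin: "finite V" "E \<subseteq> V \<times> V" and symE: "\<And>u v. (u, v) \<in> E \<Longrightarrow> (v, u) \<in> E"
    and irr: "\<And>u. (u, u) \<notin> E"
    using G unfolding simple_graph_def sym_def irrefl_def by auto
  note finN = simple_graph_finite_nbrs[OF G]
  have U: "U = {{u, v} | u v. (u, v) \<in> E}" unfolding U_def undirected_edges_def E_def ..
  define dg :: "('a set \<Rightarrow> real) \<Rightarrow> 'a \<Rightarrow> real" where "dg h v = (\<Sum>u\<in>E `` {v}. h {v, u})" for h v
  have dg_eq: "(\<Sum>e\<in>{e \<in> U. v \<in> e}. h e) = dg h v" for h :: "'a set \<Rightarrow> real" and v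
  proof -
    have inj: "inj_on (\<lambda>u. {v, u}) (E `` {v})" by (auto simp: inj_on_def doubleton_eq_iff)
    have "{e \<in> U. v \<in> e} = (\<lambda>u. {v, u}) ` (E `` {v})"
      unfolding U using symE by (fastforce simp: insert_commute)
    then show ?thesis unfolding dg_def by (simp add: sum.reindex[OF inj])
  qed
  \<comment> \<open>The point of \<open>[a, b]\<close> nearest to \<open>y\<close>; \<open>g\<close>
    below is the signed violation at a vertex.\<close>
  define clip :: "real \<Rightarrow> real" where "clip y = max (real a) (min (real b) y)" for y
  have clip_best: "(y - clip y)\<^sup>2 \<le> (y - z)\<^sup>2" if "real a \<le> z" "z \<le> real b" for y z
  proof -
    have "\<bar>y - clip y\<bar> \<le> \<bar>y - z\<bar>" using that \<open>a \<le> b\<close> unfolding clip_def by auto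
    then show ?thesis by (simp add: abs_le_square_iff)
  qed
  have clip_range: "real a \<le> clip y" "clip y \<le> real b" for y
    using \<open>a \<le> b\<close> unfolding clip_def by auto
  define \<Phi> where "\<Phi> h = (\<Sum>v\<in>V. (dg h v - clip (dg h v))\<^sup>2)" for h
  define K where "K = {h :: 'a set \<Rightarrow> real. \<forall>e. h e \<in> (if e \<in> U then {0..1} else {0})}"
  have "compact K" unfolding K_def by (intro compact_function_box) auto
  moreover have "(\<lambda>_. 0) \<in> K" unfolding K_def by auto
  then have "K \<noteq> {}" by auto
  moreover have "continuous_on K \<Phi>"
    unfolding \<Phi>_def dg_def clip_def
    by (intro continuous_intros continuous_on_subset[OF continuous_on_product_coordinates]) auto
  ultimately obtain h where hK: "h \<in> K" and min: "\<And>k. k \<in> K \<Longrightarrow> \<Phi> h \<le> \<Phi> k"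
    using continuous_attains_inf[of K \<Phi>] by blast
  have h01: "0 \<le> h e" "h e \<le> 1" if "e \<in> U" for e
    using hK that unfolding K_def by (auto dest!: spec[of _ e])
  define g where "g v = dg h v - clip (dg h v)" for v
  have perturb: "0 \<le> \<tau> * (g p + g q + \<tau>)" if pq: "(p, q) \<in> E"
    and t: "0 \<le> h {p, q} + \<tau>" "h {p, q} + \<tau> \<le> 1" for p q \<tau>
  proof -
    define k where "k = h({p, q} := h {p, q} + \<tau>)"
    have ne: "p \<noteq> q" using irr pq by auto
    have pV: "p \<in> V" "q \<in> V" using pq fin by auto
    have inU: "{p, q} \<in> U" unfolding U using pq by auto
    have "k e \<in> (if e \<in> U then {0..1} else {0})" for e
      using hK[unfolded K_def mem_Collect_eq, rule_format, of e] t inU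
      by (cases "e = {p, q}") (simp_all add: k_def)
    then have "k \<in> K" unfolding K_def by blast
    have dgk: "dg k v = dg h v + (if v = p then \<tau> else 0) + (if v = q then \<tau> else 0)" for v
    proof -
      have "dg k v = (\<Sum>u\<in>E `` {v}. h {v, u} + (if {v, u} = {p, q} then \<tau> else 0))"
        unfolding dg_def k_def by (rule sum.cong) auto
      also have "\<dots> = dg h v + (\<Sum>u\<in>E `` {v}. if {v, u} = {p, q} then \<tau> else 0)"
        unfolding dg_def by (simp add: sum.distrib)
      also have "(\<Sum>u\<in>E `` {v}. if {v, u} = {p, q} then \<tau> else 0)
          = (\<Sum>u\<in>E `` {v}. (if u = q then if v = p then \<tau> else 0 else 0)
                + (if u = p then if v = q then \<tau> else 0 else 0))"
        using ne by (intro sum.cong) (auto simp: doubleton_eq_iff)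
      also have "\<dots> = (if v = p then \<tau> else 0) + (if v = q then \<tau> else 0)"
        using finN pq symE[OF pq] unfolding sum.distrib by (auto simp: sum.delta)
      finally show ?thesis by simp
    qed
    have "\<Phi> h \<le> \<Phi> k" using min \<open>k \<in> K\<close> .
    \<comment> \<open>Measuring the new sums against the old nearest points only overestimates the
      distance, and it leaves a plain quadratic in \<open>\<tau>\<close>; no derivative of
      \<open>clip\<close> is needed.\<close>
    also have "\<dots> \<le> (\<Sum>v\<in>V. (dg k v - clip (dg h v))\<^sup>2)"
      unfolding \<Phi>_def by (intro sum_mono clip_best clip_range)
    also have "\<dots> = (\<Sum>v\<in>V. (g v)\<^sup>2 + (if v = p then 2 * \<tau> * g p + \<tau>\<^sup>2 else 0)
        + (if v = q then 2 * \<tau> * g q + \<tau>\<^sup>2 else 0))"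
      using ne by (intro sum.cong) (auto simp: dgk g_def power2_eq_square algebra_simps)
    also have "\<dots> = \<Phi> h + (2 * \<tau> * g p + \<tau>\<^sup>2) + (2 * \<tau> * g q + \<tau>\<^sup>2)"
      using pV fin by (simp add: sum.distrib \<Phi>_def g_def)
    finally show ?thesis by (simp add: power2_eq_square algebra_simps)
  qed
  have full: "h {p, q} = 1" if pq: "(p, q) \<in> E" "g p + g q < 0" for p q
  proof (rule ccontr)
    assume "h {p, q} \<noteq> 1"
    moreover have "{p, q} \<in> U" unfolding U using pq by auto
    ultimately have lt: "h {p, q} < 1" "0 \<le> h {p, q}" using h01 by (auto simp: less_le)
    \<comment> \<open>The largest change that keeps the weight at most 1, cut at half of
      \<open>-(g p + g q)\<close> so that \<open>g p + g q + \<tau>\<close> stays negative.\<close>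
    define \<tau> where "\<tau> = min (1 - h {p, q}) (- (g p + g q) / 2)"
    have half: "\<tau> \<le> - (g p + g q) / 2" unfolding \<tau>_def by (rule min.cobounded2)
    have \<tau>: "0 < \<tau>" "\<tau> \<le> 1 - h {p, q}" unfolding \<tau>_def using lt pq(2) by auto
    have neg: "g p + g q + \<tau> < 0" using half pq(2) by simp
    have "\<tau> * (g p + g q + \<tau>) < 0" using \<tau>(1) neg by (rule mult_pos_neg)
    moreover have "0 \<le> \<tau> * (g p + g q + \<tau>)" using perturb[OF pq(1), of \<tau>] \<tau> lt by simp
    ultimately show False by simp
  qed
  have empty: "h {p, q} = 0" if pq: "(p, q) \<in> E" "g p + g q > 0" for p q
  proof (rule ccontr)
    assume "h {p, q} \<noteq> 0"
    moreover have "{p, q} \<in> U" unfolding U using pq by auto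
    ultimately have lt: "h {p, q} \<le> 1" "0 < h {p, q}" using h01 by (auto simp: less_le)
    define \<tau> where "\<tau> = max (- h {p, q}) (- (g p + g q) / 2)"
    have half: "- (g p + g q) / 2 \<le> \<tau>" unfolding \<tau>_def by (rule max.cobounded2)
    have \<tau>: "\<tau> < 0" "- h {p, q} \<le> \<tau>" unfolding \<tau>_def using lt pq(2) by auto
    have pos: "g p + g q + \<tau> > 0" using half pq(2) by simp
    have "\<tau> * (g p + g q + \<tau>) < 0" using \<tau>(1) pos by (rule mult_neg_pos)
    moreover have "0 \<le> \<tau> * (g p + g q + \<tau>)" using perturb[OF pq(1), of \<tau>] \<tau> lt by simp
    ultimately show False by simp
  qed
  obtain v0 where v0: "v0 \<in> V" "g v0 \<noteq> 0"
  proof -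
    have "\<exists>v\<in>V. g v \<noteq> 0"
    proof (rule ccontr)
      assume "\<not> (\<exists>v\<in>V. g v \<noteq> 0)"
      then have "real a \<le> dg h v \<and> dg h v \<le> real b" if "v \<in> V" for v
        using that clip_range[of "dg h v"] by (simp add: g_def)
      then have "has_fractional_factor a b H"
        unfolding has_fractional_factor_def U_def[symmetric] V_def[symmetric] dg_eq
        using h01 by blast
      then show False using no by simp
    qed
    then show ?thesis using that by auto
  qed
  \<comment> \<open>This level puts \<open>v0\<close> into \<open>S\<close> or \<open>T\<close>, so
    the two are not both empty. With one level for both sets, \<open>p\<close> in \<open>T\<close>
    and \<open>q\<close> outside \<open>S\<close> give \<open>g p \<le> -c\<close> and
    \<open>g q < c\<close>, hence \<open>g p + g q < 0\<close>; the other sign is symmetric.\<close>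
  define c where "c = \<bar>g v0\<bar>"
  have c: "c > 0" using v0 unfolding c_def by simp
  define S T where "S = {v \<in> V. c \<le> g v}" and "T = {v \<in> V. g v \<le> - c}"
  have finST: "finite S" "finite T" unfolding S_def T_def using fin by auto
  have "v0 \<in> S \<union> T" unfolding S_def T_def c_def using v0 by auto
  then have cards: "card S + card T > 0" using finST by (auto simp: card_gt_0_iff)
  have dgT: "dg h v \<le> real a - c" if "v \<in> T" for v
    using that c \<open>a \<le> b\<close> unfolding T_def g_def clip_def by (auto simp: max_def min_def split: if_splits)
  have dgS: "real b + c \<le> dg h v" if "v \<in> S" for v
    using that c \<open>a \<le> b\<close> unfolding S_def g_def clip_def by (auto simp: max_def min_def split: if_splits)
  \<comment> \<open>The weight between \<open>S\<close> and \<open>T\<close>, to be counted from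
    both sides. Vertices of \<open>S\<close> receive weight from \<open>T\<close> only; vertices of
    \<open>T\<close> receive the full weight of every edge avoiding \<open>S\<close>. Eliminating
    \<open>X\<close> leaves the obstruction, and \<open>c\<close> makes it strict.\<close>
  define X where "X = (\<Sum>v\<in>T. \<Sum>u\<in>{u \<in> S. (v, u) \<in> E}. h {v, u})"
  have eqT: "dg h v = real (card (E `` {v} - S)) + (\<Sum>u\<in>{u \<in> S. (v, u) \<in> E}. h {v, u})"
    if v: "v \<in> T" for v
  proof -
    have split: "E `` {v} = (E `` {v} - S) \<union> {u \<in> S. (v, u) \<in> E}" by auto
    have "dg h v = (\<Sum>u\<in>E `` {v} - S. h {v, u}) + (\<Sum>u\<in>{u \<in> S. (v, u) \<in> E}. h {v, u})"
      unfolding dg_def by (subst split, rule sum.union_disjoint) (use finN finST in auto)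
    moreover have "h {v, u} = 1" if "u \<in> E `` {v} - S" for u
      by (rule full) (use that v fin in \<open>auto simp: T_def S_def\<close>)
    ultimately show ?thesis by simp
  qed
  have eqS: "dg h u = (\<Sum>v\<in>{v \<in> T. (v, u) \<in> E}. h {v, u})" if u: "u \<in> S" for u
  proof -
    have "dg h u = (\<Sum>v\<in>{v \<in> T. (v, u) \<in> E}. h {u, v})"
      unfolding dg_def
    proof (rule sum.mono_neutral_right)
      show "\<forall>v\<in>E `` {u} - {v \<in> T. (v, u) \<in> E}. h {u, v} = 0"
      proof
        fix v assume v: "v \<in> E `` {u} - {v \<in> T. (v, u) \<in> E}"
        show "h {u, v} = 0"
          by (rule empty) (use v u fin symE in \<open>auto simp: T_def S_def\<close>)
      qed
    qed (use finN symE in auto)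
    then show ?thesis by (simp add: insert_commute)
  qed
  have "X = (\<Sum>u\<in>S. dg h u)"
    unfolding X_def using eqS by (subst sum.swap_restrict[OF finST(2,1)]) simp
  also have "\<dots> \<ge> (\<Sum>u\<in>S. real b + c)" using dgS by (intro sum_mono)
  finally have XS: "real (card S) * (real b + c) \<le> X" by simp
  have "(\<Sum>v\<in>T. real (card (E `` {v} - S))) + X = (\<Sum>v\<in>T. dg h v)"
    unfolding X_def sum.distrib[symmetric] using eqT by simp
  also have "\<dots> \<le> (\<Sum>v\<in>T. real a - c)" using dgT by (intro sum_mono)
  finally have XT: "(\<Sum>v\<in>T. real (card (E `` {v} - S))) + X \<le> real (card T) * (real a - c)" by simp
  have "c * real (card S + card T) > 0" using c cards by (intro mult_pos_pos) auto
  then have "real b * card S + (\<Sum>v\<in>T. real (card (E `` {v} - S))) < real a * card T"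
    using XS XT by (simp add: algebra_simps)
  then have "real (b * card S + (\<Sum>v\<in>T. card (E `` {v} - S))) < real (a * card T)" by simp
  then have "b * card S + (\<Sum>v\<in>T. card (E `` {v} - S)) < a * card T" by (simp only: of_nat_less_iff)
  then show ?thesis
    by (intro that[of S T]) (use c in \<open>auto simp: S_def T_def V_def E_def\<close>)
qed

section \<open>The extremal graph\<close>

lemma pair_pre_digraph_eta: "\<lparr>pverts = pverts G, parcs = parcs G\<rparr> = G"
  by (cases G) simp

text \<open>The complete split graph: the largest graph on \<open>W\<close> in which
  \<open>I\<close> remains independent.\<close>

definition split_arcs :: "'a set \<Rightarrow> 'a set \<Rightarrow> ('a \<times> 'a) set" where
  "split_arcs W I = {(u, v). u \<in> W \<and> v \<in> W \<and> u \<noteq> v \<and> \<not> (u \<in> I \<and> v \<in> I)}"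

text \<open>The graph \<open>F\<close> on a given vertex set: \<open>I\<close>, \<open>S\<close>, \<open>R\<close>, \<open>T\<close> play the roles of $rK_1$, $K_a$,
  $K_{n-(a+b+r+1)}$, $(b+1)K_1$, and \<open>w\<close> is the vertex of \<open>T\<close> that is joined to \<open>Y\<close>.\<close>

definition F_arcs :: "'a set \<Rightarrow> 'a set \<Rightarrow> 'a set \<Rightarrow> 'a set \<Rightarrow> 'a set \<Rightarrow> 'a \<Rightarrow> ('a \<times> 'a) set" where
  "F_arcs I S R T Y w = split_arcs (I \<union> S \<union> R) I \<union> (I \<union> S) \<times> T \<union> T \<times> (I \<union> S) \<union> Y \<times> {w} \<union> {w} \<times> Y"

text \<open>Realizing \<open>F\<close> on the vertex set of \<open>G\<close> lets the two graphs be
  compared arc by arc. The placement stays a parameter because it is later chosen according to an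
  eigenvector of the other graph.\<close>

locale F_partition =
  fixes V I S R T Y :: "'a set" and w :: 'a and n a b r :: nat
  assumes fin: "finite V" and V: "V = I \<union> S \<union> R \<union> T"
    and disj: "I \<inter> S = {}" "I \<inter> R = {}" "I \<inter> T = {}" "S \<inter> R = {}" "S \<inter> T = {}" "R \<inter> T = {}"
    and cards: "card I = r" "card S = a" "card R = n - (a + b + r + 1)" "card T = b + 1"
    and Y: "Y \<subseteq> R" "card Y = a - 1" and w: "w \<in> T"
begin

lemma finite_parts: "finite I" "finite S" "finite R" "finite T" "finite Y"
  using fin V Y by (auto intro: finite_subset)

lemma simple_graph_F: "simple_graph V (F_arcs I S R T Y w)"
  unfolding simple_graph_def sym_def irrefl_def F_arcs_def split_arcs_def
  using fin V disj Y w by auto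

end

text \<open>\<open>F_graph\<close> attaches its additional edges to initial segments of the
  numbering, so the numbering of a part must send a prescribed subset to such a segment.\<close>

lemma obtain_bij_lessThan_card:
  assumes "finite A" "B \<subseteq> A"
  obtains f where "bij_betw f A {..<card A}" "\<And>x. x \<in> A \<Longrightarrow> x \<in> B \<longleftrightarrow> f x < card B"
proof -
  have fB: "finite B" and le: "card B \<le> card A" using assms by (auto intro: finite_subset card_mono)
  obtain f where f: "bij_betw f B {..<card B}"
    using ex_bij_betw_finite_nat[OF fB] by (auto simp: atLeast0LessThan)
  have "card (A - B) = card {card B..<card A}" using assms fB by (simp add: card_Diff_subset)
  then obtain g where g: "bij_betw g (A - B) {card B..<card A}"
    using finite_same_card_bij[of "A - B" "{card B..<card A}"] assms by auto
  define h where "h x = (if x \<in> B then f x else g x)" for x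
  have hB: "bij_betw h B {..<card B}" using f by (rule bij_betw_cong[THEN iffD1, rotated]) (simp add: h_def)
  have hA: "bij_betw h (A - B) {card B..<card A}"
    using g by (rule bij_betw_cong[THEN iffD1, rotated]) (simp add: h_def)
  have "bij_betw h (B \<union> (A - B)) ({..<card B} \<union> {card B..<card A})"
    by (rule bij_betw_combine[OF hB hA]) auto
  moreover have "B \<union> (A - B) = A" "{..<card B} \<union> {card B..<card A} = {..<card A}"
    using assms le by auto
  ultimately have "bij_betw h A {..<card A}" by simp
  moreover have "x \<in> B \<longleftrightarrow> h x < card B" if "x \<in> A" for x
    using bij_betwE[OF hB] bij_betwE[OF hA] that by (metis Diff_iff atLeastLessThan_iff lessThan_iff not_le)
  ultimately show ?thesis using that by blast
qed

text \<open>Transporting an enumeration along \<open>\<phi>\<close> yields literally the same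
  matrix.\<close>

lemma isomorphic_index_eq:
  assumes fin: "finite V" and bij: "bij_betw \<phi> V V'"
    and arcs: "\<And>u v. u \<in> V \<Longrightarrow> v \<in> V \<Longrightarrow> (\<phi> u, \<phi> v) \<in> E' \<longleftrightarrow> (u, v) \<in> E"
  shows "index V E = index V' E'"
proof -
  let ?G = "with_proj \<lparr>pverts = V, parcs = E\<rparr>" and ?G' = "with_proj \<lparr>pverts = V', parcs = E'\<rparr>"
  obtain xs where xs: "distinct xs" "set xs = verts ?G"
    using finite_distinct_list[OF fin] by auto
  have xs': "distinct (map \<phi> xs)" "set (map \<phi> xs) = verts ?G'"
    using xs bij by (auto simp: distinct_map bij_betw_def)
  have "adjacency_matrix ?G xs = adjacency_matrix ?G' (map \<phi> xs)"
    unfolding adjacency_matrix_def using arcs xs(2) by (intro eq_matI) auto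
  then have "adjacency_eigenvalues ?G = adjacency_eigenvalues ?G'"
    using adjacency_eigenvalue_enum[OF xs] adjacency_eigenvalue_enum[OF xs'] by auto
  then show ?thesis by (simp add: index_def largest_eigenvalue_def)
qed

lemma isomorphic_digraph_iso:
  assumes G: "simple_graph V E" and bij: "bij_betw \<phi> V V'" and sub: "E' \<subseteq> V' \<times> V'"
    and arcs: "\<And>u v. u \<in> V \<Longrightarrow> v \<in> V \<Longrightarrow> (\<phi> u, \<phi> v) \<in> E' \<longleftrightarrow> (u, v) \<in> E"
  shows "digraph_iso (with_proj \<lparr>pverts = V, parcs = E\<rparr>) (with_proj \<lparr>pverts = V', parcs = E'\<rparr>)"
proof -
  let ?G = "with_proj \<lparr>pverts = V, parcs = E\<rparr>"
  have E: "E \<subseteq> V \<times> V" using G unfolding simple_graph_def by auto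
  define f where "f = \<lparr>iso_verts = \<phi>, iso_arcs = map_prod \<phi> \<phi>, iso_head = snd, iso_tail = fst\<rparr>"
  have inj: "inj_on \<phi> V" and img: "\<phi> ` V = V'" using bij by (auto simp: bij_betw_def)
  have imgE: "map_prod \<phi> \<phi> ` E = E'"
  proof
    show "map_prod \<phi> \<phi> ` E \<subseteq> E'" using E arcs by auto
    show "E' \<subseteq> map_prod \<phi> \<phi> ` E"
    proof
      fix e assume "e \<in> E'"
      then obtain u v where "e = (\<phi> u, \<phi> v)" "u \<in> V" "v \<in> V" using sub img by (cases e) auto
      then show "e \<in> map_prod \<phi> \<phi> ` E" using arcs \<open>e \<in> E'\<close> by (auto intro!: image_eqI[of _ _ "(u, v)"])
    qed
  qed
  have "wf_digraph ?G" using E by unfold_locales auto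
  moreover have "inj_on (map_prod \<phi> \<phi>) E"
    using inj E by (auto simp: inj_on_def) blast+
  ultimately have "pre_digraph.digraph_isomorphism ?G f"
    using inj unfolding pre_digraph.digraph_isomorphism_def f_def by auto
  moreover have "with_proj \<lparr>pverts = V', parcs = E'\<rparr> = app_iso f ?G"
    using img imgE by (simp add: app_iso_def f_def with_proj_def)
  ultimately show ?thesis unfolding digraph_iso_def by blast
qed

text \<open>A table of all sixteen blocks of the arc relation. The variables \<open>m\<close>,
  \<open>t\<close>, \<open>y\<close> shield the arithmetic from the simplifier, and
  \<open>y \<le> m\<close> keeps the additional arcs inside the vertex set.\<close>

lemma F_graph_arcs:
  assumes "E = parcs (F_graph n a b r)" "m = n - (a + b + r + 1)" "t = b + 1" "y = a - 1" "y \<le> m"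
  shows "(Inl i, Inl j) \<notin> E"
    "(Inl i, Inr (Inl j)) \<in> E \<longleftrightarrow> i < r \<and> j < a"
    "(Inl i, Inr (Inr (Inl j))) \<in> E \<longleftrightarrow> i < r \<and> j < m"
    "(Inl i, Inr (Inr (Inr j))) \<in> E \<longleftrightarrow> i < r \<and> j < t"
    "(Inr (Inl i), Inl j) \<in> E \<longleftrightarrow> i < a \<and> j < r"
    "(Inr (Inl i), Inr (Inl j)) \<in> E \<longleftrightarrow> i < a \<and> j < a \<and> i \<noteq> j"
    "(Inr (Inl i), Inr (Inr (Inl j))) \<in> E \<longleftrightarrow> i < a \<and> j < m"
    "(Inr (Inl i), Inr (Inr (Inr j))) \<in> E \<longleftrightarrow> i < a \<and> j < t"
    "(Inr (Inr (Inl i)), Inl j) \<in> E \<longleftrightarrow> i < m \<and> j < r"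
    "(Inr (Inr (Inl i)), Inr (Inl j)) \<in> E \<longleftrightarrow> i < m \<and> j < a"
    "(Inr (Inr (Inl i)), Inr (Inr (Inl j))) \<in> E \<longleftrightarrow> i < m \<and> j < m \<and> i \<noteq> j"
    "(Inr (Inr (Inl i)), Inr (Inr (Inr j))) \<in> E \<longleftrightarrow> i < y \<and> j = 0"
    "(Inr (Inr (Inr i)), Inl j) \<in> E \<longleftrightarrow> i < t \<and> j < r"
    "(Inr (Inr (Inr i)), Inr (Inl j)) \<in> E \<longleftrightarrow> i < t \<and> j < a"
    "(Inr (Inr (Inr i)), Inr (Inr (Inl j))) \<in> E \<longleftrightarrow> i = 0 \<and> j < y"
    "(Inr (Inr (Inr i)), Inr (Inr (Inr j))) \<notin> E"
    "E \<subseteq> pverts (F_graph n a b r) \<times> pverts (F_graph n a b r)"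
    "pverts (F_graph n a b r) = {..<r} <+> ({..<a} <+> ({..<m} <+> {..<t}))"
  using \<open>y \<le> m\<close> unfolding assms(1-4) F_graph_def graph_join_def disjoint_union_def
    edgeless_graph_def complete_graph_def Let_def
  by auto

context F_partition begin

lemma isomorphism_F_graph:
  obtains \<phi> where "bij_betw \<phi> V (pverts (F_graph n a b r))"
    "\<And>u v. u \<in> V \<Longrightarrow> v \<in> V \<Longrightarrow>
      (\<phi> u, \<phi> v) \<in> parcs (F_graph n a b r) \<longleftrightarrow> (u, v) \<in> F_arcs I S R T Y w"
    "parcs (F_graph n a b r) \<subseteq> pverts (F_graph n a b r) \<times> pverts (F_graph n a b r)"
proof -
  let ?F = "F_graph n a b r"
  obtain m t y where m: "m = n - (a + b + r + 1)" "t = b + 1" "y = a - 1" by simp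
  have ym: "y \<le> m" using Y cards finite_parts card_mono m by metis
  obtain f1 where f1: "bij_betw f1 I {..<r}"
    using obtain_bij_lessThan_card[of I "{}"] finite_parts cards by auto
  obtain f2 where f2: "bij_betw f2 S {..<a}"
    using obtain_bij_lessThan_card[of S "{}"] finite_parts cards by auto
  obtain f3 where f3: "bij_betw f3 R {..<m}" and f3Y: "\<And>x. x \<in> R \<Longrightarrow> x \<in> Y \<longleftrightarrow> f3 x < y"
    using obtain_bij_lessThan_card[of R Y] finite_parts cards Y m by auto
  obtain f4 where f4: "bij_betw f4 T {..<t}" and f4w: "\<And>x. x \<in> T \<Longrightarrow> x = w \<longleftrightarrow> f4 x = 0"
    using obtain_bij_lessThan_card[of T "{w}"] finite_parts cards w m by auto
  define \<phi> :: "'a \<Rightarrow> nat + nat + nat + nat" where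
    "\<phi> v = (if v \<in> I then Inl (f1 v) else if v \<in> S then Inr (Inl (f2 v))
       else if v \<in> R then Inr (Inr (Inl (f3 v))) else Inr (Inr (Inr (f4 v))))" for v
  have \<phi>I: "\<phi> v = Inl (f1 v)" if "v \<in> I" for v using that by (simp add: \<phi>_def)
  have \<phi>S: "\<phi> v = Inr (Inl (f2 v))" if "v \<in> S" for v using that disj by (auto simp: \<phi>_def)
  have \<phi>R: "\<phi> v = Inr (Inr (Inl (f3 v)))" if "v \<in> R" for v using that disj by (auto simp: \<phi>_def)
  have \<phi>T: "\<phi> v = Inr (Inr (Inr (f4 v)))" if "v \<in> T" for v using that disj by (auto simp: \<phi>_def)
  note \<phi> = \<phi>I \<phi>S \<phi>R \<phi>T
  note arcs_iff = F_graph_arcs[OF refl m ym]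
  note verts = arcs_iff(18)
  have lt: "f1 v < r" if "v \<in> I" for v using bij_betwE[OF f1] that by auto
  have lt2: "f2 v < a" if "v \<in> S" for v using bij_betwE[OF f2] that by auto
  have lt3: "f3 v < m" if "v \<in> R" for v using bij_betwE[OF f3] that by auto
  have lt4: "f4 v < t" if "v \<in> T" for v using bij_betwE[OF f4] that by auto
  have inj1: "f1 u = f1 v \<longleftrightarrow> u = v" if "u \<in> I" "v \<in> I" for u v
    using f1 that by (auto simp: bij_betw_def inj_on_def)
  have inj2: "f2 u = f2 v \<longleftrightarrow> u = v" if "u \<in> S" "v \<in> S" for u v
    using f2 that by (auto simp: bij_betw_def inj_on_def)
  have inj3: "f3 u = f3 v \<longleftrightarrow> u = v" if "u \<in> R" "v \<in> R" for u v
    using f3 that by (auto simp: bij_betw_def inj_on_def)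
  have inj4: "f4 u = f4 v \<longleftrightarrow> u = v" if "u \<in> T" "v \<in> T" for u v
    using f4 that by (auto simp: bij_betw_def inj_on_def)
  have Vcases: "u \<in> V \<longleftrightarrow> u \<in> I \<or> u \<in> S \<or> u \<in> R \<or> u \<in> T" for u using V by auto
  have "inj_on \<phi> V"
  proof (rule inj_onI)
    fix u v assume "u \<in> V" "v \<in> V" and eq: "\<phi> u = \<phi> v"
    then have "u \<in> I \<or> u \<in> S \<or> u \<in> R \<or> u \<in> T" "v \<in> I \<or> v \<in> S \<or> v \<in> R \<or> v \<in> T"
      using Vcases by auto
    then show "u = v" using eq by (elim disjE) (simp_all add: \<phi> inj1 inj2 inj3 inj4)
  qed
  moreover have "\<phi> ` V = pverts ?F"
  proof -
    have img: "f1 ` I = {..<r}" "f2 ` S = {..<a}" "f3 ` R = {..<m}" "f4 ` T = {..<t}"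
      using f1 f2 f3 f4 by (auto simp: bij_betw_def)
    have parts: "\<phi> ` I = Inl ` {..<r}" "\<phi> ` S = Inr ` Inl ` {..<a}"
      "\<phi> ` R = Inr ` Inr ` Inl ` {..<m}" "\<phi> ` T = Inr ` Inr ` Inr ` {..<t}"
      unfolding img[symmetric] image_image by (auto simp: \<phi>)
    show ?thesis unfolding V image_Un parts verts by (auto simp: Plus_def image_Un)
  qed
  ultimately have bij: "bij_betw \<phi> V (pverts ?F)" by (simp add: bij_betw_def)
  have nonmem: "v \<in> I \<Longrightarrow> v \<notin> S \<and> v \<notin> R \<and> v \<notin> T \<and> v \<notin> Y \<and> v \<noteq> w"
    "v \<in> S \<Longrightarrow> v \<notin> I \<and> v \<notin> R \<and> v \<notin> T \<and> v \<notin> Y \<and> v \<noteq> w"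
    "v \<in> R \<Longrightarrow> v \<notin> I \<and> v \<notin> S \<and> v \<notin> T \<and> v \<noteq> w"
    "v \<in> T \<Longrightarrow> v \<notin> I \<and> v \<notin> S \<and> v \<notin> R \<and> v \<notin> Y" for v
    using disj Y w by auto
  \<comment> \<open>Each disjunct settles every membership that the block table can ask for, so each
    pair of blocks becomes a simplification.\<close>
  have excl: "v \<in> I \<and> v \<notin> S \<and> v \<notin> R \<and> v \<notin> T \<and> v \<notin> Y \<and> v \<noteq> w
    \<or> v \<in> S \<and> v \<notin> I \<and> v \<notin> R \<and> v \<notin> T \<and> v \<notin> Y \<and> v \<noteq> w
    \<or> v \<in> R \<and> v \<notin> I \<and> v \<notin> S \<and> v \<notin> T \<and> v \<noteq> w
    \<or> v \<in> T \<and> v \<notin> I \<and> v \<notin> S \<and> v \<notin> R \<and> v \<notin> Y" if "v \<in> V" for v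
    using that[unfolded Vcases] nonmem[of v] by argo
  have arcs: "(\<phi> u, \<phi> v) \<in> parcs ?F \<longleftrightarrow> (u, v) \<in> F_arcs I S R T Y w" if uv: "u \<in> V" "v \<in> V" for u v
  proof -
    note simps = \<phi> arcs_iff F_arcs_def split_arcs_def lt lt2 lt3 lt4 inj1 inj2 inj3 inj4 f3Y f4w
    show ?thesis
    proof (cases "u = v")
      case True
      then show ?thesis using excl[OF uv(2)] by (elim disjE conjE) (simp_all add: simps)
    next
      case False
      then show ?thesis
        using excl[OF uv(1)] excl[OF uv(2)]
        by (elim disjE conjE) (simp_all add: simps conj_commute)
    qed
  qed
  have "parcs ?F \<subseteq> pverts ?F \<times> pverts ?F" by (rule arcs_iff)
  then show ?thesis using that bij arcs by blast
qed

lemma index_F_graph: "largest_eigenvalue (with_proj (F_graph n a b r)) = index V (F_arcs I S R T Y w)"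
proof -
  obtain \<phi> where "bij_betw \<phi> V (pverts (F_graph n a b r))"
    "\<And>u v. u \<in> V \<Longrightarrow> v \<in> V \<Longrightarrow>
      (\<phi> u, \<phi> v) \<in> parcs (F_graph n a b r) \<longleftrightarrow> (u, v) \<in> F_arcs I S R T Y w"
    using isomorphism_F_graph by metis
  from isomorphic_index_eq[OF fin this] show ?thesis by (simp add: index_def pair_pre_digraph_eta)
qed

lemma digraph_iso_F_graph:
  "digraph_iso (with_proj \<lparr>pverts = V, parcs = F_arcs I S R T Y w\<rparr>) (with_proj (F_graph n a b r))"
proof -
  obtain \<phi> where "bij_betw \<phi> V (pverts (F_graph n a b r))"
    "\<And>u v. u \<in> V \<Longrightarrow> v \<in> V \<Longrightarrow>
      (\<phi> u, \<phi> v) \<in> parcs (F_graph n a b r) \<longleftrightarrow> (u, v) \<in> F_arcs I S R T Y w"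
    and "parcs (F_graph n a b r) \<subseteq> pverts (F_graph n a b r) \<times> pverts (F_graph n a b r)"
    using isomorphism_F_graph by metis
  from isomorphic_digraph_iso[OF simple_graph_F this(1,3,2)] show ?thesis by (simp add: pair_pre_digraph_eta)
qed

end

section \<open>Estimates for the largest eigenvalue\<close>

lemma card_split_arcs:
  assumes "finite W" "I \<subseteq> W"
  shows "real (card (split_arcs W I)) = real (card W) * (real (card W) - 1) - real (card I) * (real (card I) - 1)"
proof -
  have fI: "finite I" and le: "card I \<le> card W" using assms by (auto intro: finite_subset card_mono)
  have "split_arcs W I = (SIGMA u:W. if u \<in> I then W - I else W - {u})"
    unfolding split_arcs_def using assms by (auto split: if_splits)
  then have "card (split_arcs W I) = (\<Sum>u\<in>W. card (if u \<in> I then W - I else W - {u}))"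
    using assms by simp
  also have "real \<dots> = (\<Sum>u\<in>W. if u \<in> I then real (card W) - real (card I) else real (card W) - 1)"
    unfolding of_nat_sum
  proof (rule sum.cong[OF refl])
    fix u assume u: "u \<in> W"
    then have "1 \<le> card W" using assms by (metis One_nat_def Suc_leI card_gt_0_iff empty_iff)
    then show "real (card (if u \<in> I then W - I else W - {u}))
        = (if u \<in> I then real (card W) - real (card I) else real (card W) - 1)"
      using u assms fI le by (simp add: card_Diff_subset of_nat_diff)
  qed
  also have "\<dots> = (real (card W) - real (card I)) * card I + (real (card W) - 1) * (real (card W) - real (card I))"
  proof -
    have "W \<inter> {x. x \<in> I} = I" "W \<inter> - {x. x \<in> I} = W - I" using assms by auto
    then show ?thesis using assms fI le
      by (simp add: sum.If_cases card_Diff_subset of_nat_diff)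
  qed
  finally show ?thesis by (simp add: algebra_simps)
qed

text \<open>The indicator of \<open>W\<close> as test vector: the eigenvalue is at least the average
  degree of the split graph on \<open>W\<close>.\<close>

lemma index_ge_of_split_arcs:
  assumes G: "simple_graph V E" and W: "W \<subseteq> V" "W \<noteq> {}" "I \<subseteq> W" and sub: "split_arcs W I \<subseteq> E"
  shows "real (card W) * (real (card W) - 1) - real (card I) * (real (card I) - 1) \<le> index V E * real (card W)"
proof -
  have fin: "finite V" "finite W" using G W unfolding simple_graph_def by (auto intro: finite_subset)
  define f :: "'a \<Rightarrow> real" where "f = indicator W"
  have "(\<Sum>(u, v)\<in>split_arcs W I. f u * f v) = (\<Sum>e\<in>split_arcs W I. 1)"
    by (rule sum.cong) (auto simp: split_arcs_def f_def)
  then have "real (card (split_arcs W I)) = (\<Sum>(u, v)\<in>split_arcs W I. f u * f v)"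
    by simp
  also have "\<dots> \<le> adjacency_form E f f"
    unfolding adjacency_form_def using sub simple_graph_finite_arcs[OF G]
    by (intro sum_mono2) (auto simp: f_def)
  also have "\<dots> \<le> index V E * (\<Sum>v\<in>V. (f v)\<^sup>2)"
    using index_Rayleigh[OF G, of "adjacency_form E f f \<le> index V E * (\<Sum>v\<in>V. (f v)\<^sup>2)"] W by auto
  also have "(\<Sum>v\<in>V. (f v)\<^sup>2) = real (card W)"
  proof -
    have "(f v)\<^sup>2 = indicator W v" for v unfolding f_def by (simp add: indicator_def)
    moreover have "(\<Sum>v\<in>V. indicator W v :: real) = (\<Sum>v\<in>W. 1)"
      using fin W by (intro sum.mono_neutral_cong_right) auto
    ultimately show ?thesis by simp
  qed
  finally show ?thesis using card_split_arcs[OF fin(2) W(3)] by simp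
qed

lemma index_eigenvector_normalized:
  assumes G: "simple_graph V E" and ne: "V \<noteq> {}"
  obtains x p where "\<And>v. v \<in> V \<Longrightarrow> 0 \<le> x v" "\<And>v. v \<in> V \<Longrightarrow> x v \<le> 1" "p \<in> V" "x p = 1"
    "\<And>v. v \<in> V \<Longrightarrow> (\<Sum>u\<in>E `` {v}. x u) = index V E * x v"
proof -
  obtain y where y: "\<And>v. v \<in> V \<Longrightarrow> 0 \<le> y v" "\<exists>v\<in>V. y v \<noteq> 0"
    "\<And>v. v \<in> V \<Longrightarrow> (\<Sum>u\<in>E `` {v}. y u) = index V E * y v"
    using index_Rayleigh[OF G ne] by metis
  have fin: "finite V" using G unfolding simple_graph_def by auto
  define c where "c = Max (y ` V)"
  have "c \<in> y ` V" unfolding c_def using fin ne by (intro Max_in) auto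
  then obtain p where p: "p \<in> V" "y p = c" by auto
  have le: "y v \<le> c" if "v \<in> V" for v unfolding c_def using fin that by auto
  have c: "c > 0" using y(1,2) le by (metis less_eq_real_def order_less_le_trans)
  show ?thesis
  proof (rule that[of "\<lambda>v. y v / c" p])
    show "(\<Sum>u\<in>E `` {v}. y u / c) = index V E * (y v / c)" if "v \<in> V" for v
      using y(3)[OF that] by (simp add: sum_divide_distrib[symmetric])
  qed (use p c y le in auto)
qed

section \<open>Entries of an eigenvector with maximal entry 1\<close>

locale normalized_eigenvector =
  fixes V :: "'a set" and E :: "('a \<times> 'a) set" and x :: "'a \<Rightarrow> real" and p :: 'a and k :: real
  assumes G: "simple_graph V E"
    and nonneg: "v \<in> V \<Longrightarrow> 0 \<le> x v" and le_1: "v \<in> V \<Longrightarrow> x v \<le> 1"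
    and p: "p \<in> V" "x p = 1"
    and eigen: "v \<in> V \<Longrightarrow> (\<Sum>u\<in>E `` {v}. x u) = k * x v"
    and k_pos: "0 < k"
begin

lemma fin: "finite V"
  using G by (simp add: simple_graph_def)

text \<open>The neighbours of \<open>p\<close> contribute exactly \<open>k\<close>, and
  \<open>p\<close> itself contributes 1 more.\<close>

lemma eigenvalue_le_sum: "k + 1 \<le> sum x V"
proof -
  have "p \<notin> E `` {p}" using G by (auto simp: simple_graph_def irrefl_def)
  then have "k = (\<Sum>u\<in>E `` {p}. x u)" "E `` {p} \<subseteq> V - {p}"
    using eigen[OF p(1)] p simple_graph_nbrs_subset[OF G] by auto
  moreover from this have "sum x (E `` {p}) \<le> sum x (V - {p})"
    using fin nonneg by (intro sum_mono2) auto
  ultimately have "k \<le> sum x (V - {p})" by simp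
  then show ?thesis using fin p by (simp add: sum_diff1)
qed

lemma entry_le_degree: "v \<in> V \<Longrightarrow> k * x v \<le> card (E `` {v})"
proof -
  assume v: "v \<in> V"
  have "sum x (E `` {v}) \<le> real (card (E `` {v})) * 1"
    by (rule sum_bounded_above) (use le_1 simple_graph_nbrs_subset[OF G, of v] in blast)
  then show ?thesis using eigen[OF v] by simp
qed

lemma sum_le_degrees:
  assumes "T \<subseteq> V"
  shows "k * sum x T \<le> (\<Sum>v\<in>T. card (E `` {v}))"
  using entry_le_degree assms by (auto simp: sum_distrib_left intro!: sum_mono)

text \<open>Entries outside \<open>T\<close> are at most 1, so what is missing from the total
  \<open>k + 1\<close> must lie on \<open>T\<close>, where entries are at most degree divided by
  \<open>k\<close>.\<close>

lemma eigenvalue_le_order_minus_card: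
  assumes "T \<subseteq> V"
  shows "k * (k + 1 - (real (card V) - real (card T))) \<le> (\<Sum>v\<in>T. card (E `` {v}))"
proof -
  have "sum x (V - T) \<le> (\<Sum>v\<in>V - T. 1)" using le_1 by (intro sum_mono) auto
  also have "\<dots> = real (card V) - real (card T)"
    using assms fin by (simp add: card_Diff_subset finite_subset of_nat_diff card_mono)
  finally have "k + 1 - (real (card V) - real (card T)) \<le> sum x T"
    using eigenvalue_le_sum sum.subset_diff[OF assms fin, of x] by simp
  then have "k * (k + 1 - (real (card V) - real (card T))) \<le> k * sum x T"
    using k_pos by simp
  then show ?thesis using sum_le_degrees[OF assms] by simp
qed

text \<open>Since \<open>u\<close> sees all of \<open>V - T\<close> except itself,
  \<open>(k + 1) * x u\<close> is at least the sum over \<open>V - T\<close>. By \<open>D\<close>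
  the set \<open>T\<close> carries at most 1 of the total \<open>k + 1\<close>, which leaves
  \<open>k\<close>.\<close>

lemma clique_entry_ge:
  assumes "T \<subseteq> V" and sub: "split_arcs (V - T) I \<subseteq> E" and u: "u \<in> V - T - I"
    and D: "(\<Sum>v\<in>T. card (E `` {v})) \<le> k"
  shows "1 - 1 / (k + 1) \<le> x u"
proof -
  have "V - T - {u} \<subseteq> E `` {u}" using sub u unfolding split_arcs_def by auto
  then have "sum x (V - T - {u}) \<le> sum x (E `` {u})"
    using simple_graph_finite_nbrs[OF G] simple_graph_nbrs_subset[OF G, of u] nonneg
    by (intro sum_mono2) blast+
  then have "sum x (V - T) \<le> (k + 1) * x u"
    using fin u eigen[of u] by (simp add: sum_diff1 algebra_simps)
  moreover have "sum x T \<le> 1"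
  proof -
    have "k * sum x T \<le> k * 1" using sum_le_degrees[OF assms(1)] D by simp
    then show ?thesis using k_pos by simp
  qed
  ultimately have "k \<le> (k + 1) * x u"
    using eigenvalue_le_sum sum.subset_diff[OF assms(1) fin, of x] by simp
  then show ?thesis using k_pos by (simp add: field_simps)
qed

end

text \<open>With \<open>c\<close> the least value on \<open>B\<close>, the entries of
  \<open>A - B\<close> are at most \<open>c\<close> and those of \<open>B - A\<close> at least
  \<open>c\<close>. So the sums differ by at most \<open>(|A| - |B|) * c\<close>, and the sign of
  \<open>|A| - |B|\<close> decides whether \<open>c \<le> 1\<close> or \<open>m \<le> c\<close> is
  the useful bound.\<close>

lemma sum_le_dominating_sum:
  fixes f :: "'a \<Rightarrow> real"
  assumes fin: "finite A" "finite B" and "B \<noteq> {}"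
    and dom: "\<And>u v. u \<in> B \<Longrightarrow> v \<in> A - B \<Longrightarrow> f v \<le> f u"
    and bounds: "\<And>u. u \<in> B \<Longrightarrow> m \<le> f u" "\<And>u. u \<in> B \<Longrightarrow> f u \<le> 1"
  shows "card B \<le> card A \<Longrightarrow> sum f A \<le> sum f B + (real (card A) - real (card B))"
    and "card A \<le> card B \<Longrightarrow> sum f A + (real (card B) - real (card A)) * m \<le> sum f B"
proof -
  define c where "c = Min (f ` B)"
  have "c \<in> f ` B" unfolding c_def using fin \<open>B \<noteq> {}\<close> by (intro Min_in) auto
  then have c: "m \<le> c" "c \<le> 1" "\<And>v. v \<in> A - B \<Longrightarrow> f v \<le> c" using dom bounds by auto
  have c': "\<And>u. u \<in> B \<Longrightarrow> c \<le> f u" unfolding c_def using fin by auto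
  have "sum f A = sum f (A - B) + sum f (A \<inter> B)" "sum f B = sum f (B - A) + sum f (A \<inter> B)"
    using sum.Int_Diff[OF fin(1), of f B] sum.Int_Diff[OF fin(2), of f A] by (simp_all add: Int_commute)
  moreover have "sum f (A - B) \<le> card (A - B) * c"
    using c sum_bounded_above[of "A - B" f c] by simp
  moreover have "card (B - A) * c \<le> sum f (B - A)"
    using c' sum_bounded_below[of "B - A" c f] by simp
  moreover have "real (card A) = real (card (A - B)) + real (card (A \<inter> B))"
    "real (card B) = real (card (B - A)) + real (card (A \<inter> B))"
    using card_Int_Diff[OF fin(1), of B] card_Int_Diff[OF fin(2), of A] by (simp_all add: Int_commute)
  ultimately have main: "sum f A \<le> sum f B + (real (card A) - real (card B)) * c"
    by (simp add: algebra_simps)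
  show "sum f A \<le> sum f B + (real (card A) - real (card B))" if "card B \<le> card A"
    using main mult_left_mono[OF c(2), of "real (card A) - real (card B)"] that by simp
  show "sum f A + (real (card B) - real (card A)) * m \<le> sum f B" if "card A \<le> card B"
    using main mult_left_mono[OF c(1), of "real (card B) - real (card A)"] that
    by (simp add: algebra_simps)
qed

lemma obtain_top_subset:
  fixes f :: "'a \<Rightarrow> real"
  assumes "finite A" "k \<le> card A"
  obtains B where "B \<subseteq> A" "card B = k" "\<And>u v. u \<in> B \<Longrightarrow> v \<in> A - B \<Longrightarrow> f v \<le> f u"
proof -
  have "\<exists>B\<subseteq>A. card B = k \<and> (\<forall>u\<in>B. \<forall>v\<in>A - B. f v \<le> f u)"
    using assms(2)
  proof (induction k)
    case 0
    show ?case by (intro exI[of _ "{}"]) auto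
  next
    case (Suc k)
    then obtain B where B: "B \<subseteq> A" "card B = k" "\<forall>u\<in>B. \<forall>v\<in>A - B. f v \<le> f u" by auto
    have fB: "finite B" using B assms by (auto intro: finite_subset)
    have "A - B \<noteq> {}" using Suc.prems B by (metis Diff_eq_empty_iff card_mono fB not_less_eq_eq)
    then have "Max (f ` (A - B)) \<in> f ` (A - B)" using assms by (intro Max_in) auto
    then obtain q where q: "q \<in> A - B" "f q = Max (f ` (A - B))" by auto
    have "f v \<le> f q" if "v \<in> A - B" for v using q assms that by auto
    then show ?case using B q fB by (intro exI[of _ "insert q B"]) auto
  qed
  then show ?thesis using that by blast
qed

text \<open>Two graphs that agree off \<open>T\<close> differ in their forms only by the sum over
  \<open>T\<close>. Arcs leaving \<open>T\<close> are in the first term, arcs entering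
  \<open>T\<close> in the second; removing \<open>T\<close> there prevents counting arcs inside
  \<open>T\<close> twice.\<close>

lemma adjacency_form_split:
  assumes G: "simple_graph V E" and "T \<subseteq> V"
    and core: "\<And>u v. u \<in> V - T \<Longrightarrow> v \<in> V - T \<Longrightarrow> (u, v) \<in> E \<longleftrightarrow> (u, v) \<in> split_arcs (V - T) I"
  shows "adjacency_form E x z = adjacency_form (split_arcs (V - T) I) x z
    + (\<Sum>v\<in>T. x v * (\<Sum>u\<in>E `` {v}. z u) + z v * (\<Sum>u\<in>E `` {v} - T. x u))"
proof -
  let ?W = "V - T" let ?C = "split_arcs (V - T) I"
  have fin: "finite V" "finite T" "finite ?W" and sub: "E \<subseteq> V \<times> V" and sym: "\<And>u v. (u, v) \<in> E \<longleftrightarrow> (v, u) \<in> E"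
    using G \<open>T \<subseteq> V\<close> unfolding simple_graph_def sym_def by (auto intro: finite_subset)
  have C: "simple_graph ?W ?C"
    unfolding simple_graph_def sym_def irrefl_def split_arcs_def using fin by auto
  have nb: "(\<Sum>v\<in>E `` {u}. z v) = (\<Sum>v\<in>?C `` {u}. z v) + (\<Sum>v\<in>{v \<in> T. (u, v) \<in> E}. z v)"
    if u: "u \<in> ?W" for u
  proof -
    have "E `` {u} = ?C `` {u} \<union> {v \<in> T. (u, v) \<in> E}" 
      using core[OF u] sub \<open>T \<subseteq> V\<close> by (auto simp: split_arcs_def)
    moreover have "?C `` {u} \<inter> {v \<in> T. (u, v) \<in> E} = {}" by (auto simp: split_arcs_def)
    ultimately show ?thesis
      using simple_graph_finite_nbrs[OF C] fin by (simp add: sum.union_disjoint)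
  qed
  have "adjacency_form E x z = (\<Sum>u\<in>?W. x u * (\<Sum>v\<in>E `` {u}. z v)) + (\<Sum>v\<in>T. x v * (\<Sum>u\<in>E `` {v}. z u))"
    unfolding adjacency_form_nbrs[OF G] using sum.subset_diff[OF \<open>T \<subseteq> V\<close> fin(1)] by blast
  also have "(\<Sum>u\<in>?W. x u * (\<Sum>v\<in>E `` {u}. z v)) = adjacency_form ?C x z
      + (\<Sum>u\<in>?W. \<Sum>v\<in>{v \<in> T. (u, v) \<in> E}. x u * z v)"
    unfolding adjacency_form_nbrs[OF C] by (simp add: nb sum.distrib[symmetric] distrib_left sum_distrib_left)
  also have "(\<Sum>u\<in>?W. \<Sum>v\<in>{v \<in> T. (u, v) \<in> E}. x u * z v)
      = (\<Sum>v\<in>T. \<Sum>u\<in>{u \<in> ?W. (u, v) \<in> E}. x u * z v)"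
    by (rule sum.swap_restrict[OF fin(3,2)])
  also have "\<dots> = (\<Sum>v\<in>T. z v * (\<Sum>u\<in>E `` {v} - T. x u))"
  proof (rule sum.cong[OF refl])
    fix v assume "v \<in> T"
    have "{u \<in> ?W. (u, v) \<in> E} = E `` {v} - T" using sub sym by auto
    then show "(\<Sum>u\<in>{u \<in> ?W. (u, v) \<in> E}. x u * z v) = z v * (\<Sum>u\<in>E `` {v} - T. x u)"
      by (simp add: sum_distrib_left mult.commute)
  qed
  finally show ?thesis by (simp add: sum.distrib)
qed

section \<open>Neighbourhoods and degrees in the extremal graph\<close>

context F_partition begin

lemma not_in_parts:
  "v \<in> I \<Longrightarrow> v \<notin> S \<and> v \<notin> R \<and> v \<notin> T \<and> v \<notin> Y \<and> v \<noteq> w"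
  "v \<in> S \<Longrightarrow> v \<notin> I \<and> v \<notin> R \<and> v \<notin> T \<and> v \<notin> Y \<and> v \<noteq> w"
  "v \<in> R \<Longrightarrow> v \<notin> I \<and> v \<notin> S \<and> v \<notin> T \<and> v \<noteq> w"
  "v \<in> T \<Longrightarrow> v \<notin> I \<and> v \<notin> S \<and> v \<notin> R \<and> v \<notin> Y"
  using disj Y w by auto

lemma non_T: "V - T = I \<union> S \<union> R"
  using V disj by auto

lemma nbrs:
  "v \<in> T - {w} \<Longrightarrow> F_arcs I S R T Y w `` {v} = I \<union> S"
  "F_arcs I S R T Y w `` {w} = I \<union> S \<union> Y"
  "v \<in> S \<Longrightarrow> F_arcs I S R T Y w `` {v} = (V - T - {v}) \<union> T"
  "v \<in> Y \<Longrightarrow> F_arcs I S R T Y w `` {v} = (V - T - {v}) \<union> {w}"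
  "v \<in> R - Y \<Longrightarrow> F_arcs I S R T Y w `` {v} = V - T - {v}"
proof -
  have times: "(A \<times> B) `` {v} = (if v \<in> A then B else {})" for A B :: "'a set" and v by auto
  have split: "split_arcs W I `` {v} = (if v \<in> W then if v \<in> I then W - I else W - {v} else {})" for W v
    unfolding split_arcs_def by auto
  note expand = F_arcs_def Un_Image times split non_T
  show "F_arcs I S R T Y w `` {v} = I \<union> S" if "v \<in> T - {w}"
    using that not_in_parts(4)[of v] by (simp add: expand)
  show "F_arcs I S R T Y w `` {w} = I \<union> S \<union> Y"
    using not_in_parts(4)[OF w] w by (simp add: expand)
  show "F_arcs I S R T Y w `` {v} = (V - T - {v}) \<union> T" if "v \<in> S"
    using that not_in_parts(2)[OF that] by (simp add: expand)
  show "F_arcs I S R T Y w `` {v} = (V - T - {v}) \<union> {w}" if "v \<in> Y"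
    using that Y not_in_parts(3)[of v] by (auto simp add: expand)
  show "F_arcs I S R T Y w `` {v} = V - T - {v}" if "v \<in> R - Y"
    using that not_in_parts(3)[of v] by (simp add: expand)
qed

lemma core:
  assumes "u \<in> V - T" "v \<in> V - T"
  shows "(u, v) \<in> F_arcs I S R T Y w \<longleftrightarrow> (u, v) \<in> split_arcs (V - T) I"
  using assms w not_in_parts(4)[of u] not_in_parts(4)[of v] V
  by (auto simp: F_arcs_def split_arcs_def)

lemma sum_degrees: "(\<Sum>v\<in>T. card (F_arcs I S R T Y w `` {v})) = (b + 1) * (a + r) + (a - 1)"
proof -
  have IS: "card (I \<union> S) = a + r" using finite_parts disj cards by (simp add: card_Un_disjoint)
  have ISY: "card (I \<union> S \<union> Y) = a + r + (a - 1)"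
    using finite_parts disj Y IS by (subst card_Un_disjoint) auto
  have "(\<Sum>v\<in>T. card (F_arcs I S R T Y w `` {v}))
      = card (I \<union> S \<union> Y) + (\<Sum>v\<in>T - {w}. card (F_arcs I S R T Y w `` {v}))"
    using finite_parts w by (simp add: sum.remove nbrs)
  also have "(\<Sum>v\<in>T - {w}. card (F_arcs I S R T Y w `` {v})) = b * (a + r)"
    using finite_parts w cards by (simp add: nbrs IS)
  finally show ?thesis using ISY by simp
qed

end

text \<open>The forms in which the order bound is used: \<open>?A\<close> makes the eigenvalue
  exceed the total degree of \<open>T\<close>, \<open>?B\<close> makes the loss from the independent
  set \<open>I\<close> at most 1/4, \<open>?C\<close> leaves room for the parts of \<open>F\<close>,
  \<open>?D\<close> is a crude linear bound, and \<open>?E\<close> excludes the moderately large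
  \<open>T\<close>.\<close>

lemma order_ge:
  fixes a b r n :: nat
  assumes "1 \<le> r" "r + 2 \<le> a" "a \<le> b" "2 * (4 * b + a + r + 2) * (b + r + 2) \<le> n"
  shows "(b + 1) * (a + r) + a + 5 * b + 5 * a + 2 * r + 10 \<le> n" (is ?A)
    and "b + 1 + 4 * (r * r) + 4 \<le> n" (is ?B)
    and "2 * a + b + r + 1 \<le> n" (is ?C)
    and "40 * b + 20 \<le> n" (is ?D)
    and "4 * (r + a + 5 * b) * (b + 2) + 3 * (b + 3) + 12 * b < 3 * n" (is ?E)
proof -
  have n: "8*(b*b) + 10*(b*r) + 20*b + 2*(a*b) + 2*(a*r) + 4*a + 2*(r*r) + 8*r + 8 \<le> n"
    using assms(4) by (simp add: algebra_simps)
  have bb: "3 * b \<le> b * b" using assms by (intro mult_right_mono) auto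
  have rr: "r * r \<le> b * r" using assms by (intro mult_right_mono) auto
  have br: "b \<le> b * r" using assms by simp
  have ab: "3 * b \<le> a * b" using assms by (intro mult_right_mono) auto
  have ab': "a * b \<le> b * b" using assms by (intro mult_right_mono) auto
  show ?A using n bb br ab assms(1-3) by (simp add: algebra_simps)
  show ?B using n bb rr br assms(1-3) by linarith
  show ?C using n assms(1-3) by simp
  show ?D using n bb br ab assms(1-3) by linarith
  show ?E using n bb br ab ab' rr assms(1-3) by (simp add: algebra_simps)
qed

text \<open>The left side of \<open>upper\<close> is about \<open>k * (t - b - 1)\<close>. For
  \<open>t \<le> 5 * b + 1\<close> also \<open>s \<le> 5 * b\<close>, so \<open>k\<close> would be
  bounded independently of \<open>n\<close>. For larger \<open>t\<close> the factor \<open>t\<close>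
  cancels and \<open>k\<close> is bounded through \<open>s\<close>, which is at most half the
  order.\<close>

lemma large_T_numeric:
  fixes a b r s t n :: nat and k :: real
  assumes "1 \<le> r" "r + 2 \<le> a" "a \<le> b" "2 * (4 * b + a + r + 2) * (b + r + 2) \<le> n"
    and "b + 2 \<le> t" "s < t" "s + t + r \<le> n"
    and k: "real n - b - 9/4 \<le> k"
    and upper: "k * (k + 1 - (real n - real t)) \<le> real ((r + s + a) * t)"
  shows False
proof -
  note n = order_ge[OF assms(1-4)]
  have n4: "40 * real b + 20 \<le> real n" using n(4) by linarith
  have n5: "4 * (real r + a + 5 * b) * (real b + 2) + 3 * (real b + 3) + 12 * b < 3 * real n"
  proof -
    have "real (4 * (r + a + 5 * b) * (b + 2) + 3 * (b + 3) + 12 * b) < real (3 * n)"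
      using n(5) by (simp only: of_nat_less_iff)
    then show ?thesis by (simp add: algebra_simps)
  qed
  have k0: "0 < k" using k n4 by simp
  have "k * (real t - b - 5/4) \<le> k * (k + 1 - (real n - real t))"
    using k k0 by (intro mult_left_mono) auto
  then have main: "k * (real t - b - 5/4) \<le> (real r + s + a) * t"
    using upper by simp
  show False
  proof (cases "t \<le> 5 * b + 1")
    case True
    define j where "j = t - b - 1"
    have j: "t = j + b + 1" "1 \<le> j" "j \<le> 4 * b" using assms(5) True unfolding j_def by auto
    \<comment> \<open>Here \<open>t - b - 5/4\<close> equals \<open>j - 1/4\<close>, which is at
      least \<open>3/4 * j\<close> because \<open>j \<ge> 1\<close>.\<close>
    have "k * (3/4 * real j) \<le> k * (real t - b - 5/4)"
      using k0 j by (intro mult_left_mono) auto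
    also have "\<dots> \<le> (real r + s + a) * t" by (rule main)
    also have "\<dots> \<le> (real r + 5 * b + a) * t"
      using assms(6) j by (intro mult_right_mono) auto
    also have "\<dots> \<le> (real r + 5 * b + a) * (real j * (real b + 2))"
    proof (intro mult_left_mono)
      have "b + 1 \<le> j * (b + 1)" using mult_le_mono1[OF j(2), of "b + 1"] by simp
      then have "t \<le> j * (b + 2)" using j by (simp add: algebra_simps)
      then have "real t \<le> real (j * (b + 2))" by (simp only: of_nat_le_iff)
      then show "real t \<le> real j * (real b + 2)" by (simp add: algebra_simps)
    qed simp
    finally have "real j * (3/4 * k) \<le> real j * ((real r + 5 * b + a) * (real b + 2))"
      by (simp add: algebra_simps)
    then have "3/4 * k \<le> (real r + 5 * b + a) * (real b + 2)"
      by (rule mult_left_le_imp_le) (use j(2) in simp)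
    then have "3 * k \<le> 4 * (real r + a + 5 * b) * (real b + 2)" by (simp add: algebra_simps)
    then show False using n5 k assms(1-3) by (simp add: algebra_simps)
  next
    case False
    have b: "3 \<le> b" using assms(1-3) by simp
    have t: "5 * real b + 2 \<le> real t" using False by linarith
    \<comment> \<open>Any fraction above 1/5 works for large \<open>b\<close>; 27/100 already works
      for \<open>b = 3\<close> and leaves 73/100, safely above the 1/2 needed against
      \<open>s\<close>.\<close>
    have "real b + 5/4 \<le> 27/100 * real t" using t b by simp
    then have "73/100 * real t \<le> real t - b - 5/4" by simp
    then have "k * (73/100 * real t) \<le> k * (real t - b - 5/4)" using k0 by (intro mult_left_mono) auto
    then have "real t * (73/100 * k) \<le> real t * (real r + s + a)" using main by (simp add: algebra_simps)
    then have "73/100 * k \<le> real r + s + a" by (rule mult_left_le_imp_le) (use assms(5) in simp)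
    moreover have "2 * real s \<le> real n - r" using assms(6,7) by linarith
    ultimately show False using k n4 assms(1-3) by simp
  qed
qed


context F_partition begin

text \<open>The split graph on the \<open>n - b - 1\<close> vertices off \<open>T\<close> has
  average degree \<open>n - b - 2\<close>, less \<open>r * (r - 1) / (n - b - 1)\<close> for the
  arcs missing inside \<open>I\<close>; the assumption on \<open>n\<close> makes this loss at most
  1/4.\<close>

lemma index_F_ge:
  assumes n: "b + 1 + 4 * (r * r) + 4 \<le> n" and cV: "card V = n"
  shows "real n - b - 9/4 \<le> index V (F_arcs I S R T Y w)"
proof -
  let ?N = "real n - real b - 1" and ?k = "index V (F_arcs I S R T Y w)"
  have cW: "real (card (V - T)) = ?N"
    using n cV cards finite_parts V by (simp add: card_Diff_subset of_nat_diff)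
  have N: "4 * (real r * real r) \<le> ?N" "0 < ?N"
  proof -
    have "real (b + 1 + 4 * (r * r) + 4) \<le> real n" using n by (simp only: of_nat_le_iff)
    moreover have "0 \<le> real r * real r" by simp
    ultimately show "4 * (real r * real r) \<le> ?N" "0 < ?N" by (simp_all, linarith)
  qed
  have sub: "split_arcs (V - T) I \<subseteq> F_arcs I S R T Y w"
    unfolding F_arcs_def non_T by auto
  have "V - T \<noteq> {}" using cW N(2) by (metis card.empty less_irrefl of_nat_0)
  then have "?N * (?N - 1) - real r * (real r - 1) \<le> ?k * ?N"
    using index_ge_of_split_arcs[OF simple_graph_F _ _ _ sub] cW cards disj V by auto
  moreover have "real r * (real r - 1) \<le> 1/4 * ?N"
    using N(1) unfolding right_diff_distrib by linarith
  ultimately have "?N * (?N - 1 - 1/4) \<le> ?N * ?k"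
    using right_diff_distrib[of ?N "?N - 1" "1/4"] mult.commute[of ?k ?N] by linarith
  then have "?N - 1 - 1/4 \<le> ?k" using N(2) by (rule mult_left_le_imp_le)
  then show ?thesis by simp
qed

end

text \<open>Neighbours of \<open>T\<close> in \<open>I\<close> and \<open>S\<close> number at most
  \<open>r + |S|\<close> per vertex, and the obstruction bounds the others by \<open>a * |T|\<close>
  in total. So few arcs meet \<open>T\<close> that the eigenvalue cannot reach the bound known for
  \<open>F\<close>.\<close>

lemma index_less_of_large_T:
  fixes a b r n :: nat
  assumes num: "1 \<le> r" "r + 2 \<le> a" "a \<le> b" "2 * (4 * b + a + r + 2) * (b + r + 2) \<le> n"
    and G: "simple_graph V E" and cV: "card V = n"
    and sub: "I \<subseteq> V" "S \<subseteq> V" "T \<subseteq> V" "I \<inter> S = {}" "I \<inter> T = {}" "S \<inter> T = {}"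
    and cI: "card I = r" and T: "b + 2 \<le> card T"
    and obstr: "b * card S + (\<Sum>v\<in>T. card (E `` {v} - I - S)) < a * card T"
  shows "index V E < real n - b - 9/4"
proof (rule ccontr)
  assume "\<not> index V E < real n - b - 9/4"
  then have k: "real n - b - 9/4 \<le> index V E" by simp
  have n: "40 * b + 20 \<le> n" using order_ge[OF num] by simp
  then have k0: "0 < index V E" using k by simp
  have ne: "V \<noteq> {}" using cV n by auto
  obtain x p where x: "\<And>v. v \<in> V \<Longrightarrow> 0 \<le> x v" "\<And>v. v \<in> V \<Longrightarrow> x v \<le> 1" "p \<in> V" "x p = 1"
    "\<And>v. v \<in> V \<Longrightarrow> (\<Sum>u\<in>E `` {v}. x u) = index V E * x v"
    using index_eigenvector_normalized[OF G ne] by metis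
  interpret normalized_eigenvector V E x p "index V E"
    by unfold_locales (use G x k0 in auto)
  have finS: "finite S" "finite I" "finite T" using fin sub by (auto intro: finite_subset)
  have "b * card S < b * card T"
    using obstr mult_le_mono1[OF num(3), of "card T"] by linarith
  then have st: "card S < card T" by simp
  have "card (S \<union> T \<union> I) = card S + card T + r"
    using finS sub cI by (subst card_Un_disjoint; (simp add: card_Un_disjoint)?) auto
  moreover have "card (S \<union> T \<union> I) \<le> n"
    using sub fin cV by (metis Un_least card_mono)
  ultimately have stn: "card S + card T + r \<le> n" by simp
  have deg: "card (E `` {v}) \<le> r + card S + card (E `` {v} - I - S)" for v
  proof -
    have "E `` {v} \<subseteq> I \<union> S \<union> (E `` {v} - I - S)" by auto
    then have "card (E `` {v}) \<le> card (I \<union> S \<union> (E `` {v} - I - S))"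
      using finS simple_graph_finite_nbrs[OF G] by (intro card_mono) auto
    also have "\<dots> \<le> card I + card S + card (E `` {v} - I - S)"
      by (meson add_le_mono1 card_Un_le order_trans)
    finally show ?thesis using cI by simp
  qed
  have "(\<Sum>v\<in>T. card (E `` {v})) \<le> (\<Sum>v\<in>T. r + card S + card (E `` {v} - I - S))"
    by (intro sum_mono deg)
  also have "\<dots> = (r + card S) * card T + (\<Sum>v\<in>T. card (E `` {v} - I - S))"
    by (simp add: sum.distrib)
  also have "\<dots> \<le> (r + card S + a) * card T"
    using obstr by (simp add: algebra_simps)
  finally have degs: "real (\<Sum>v\<in>T. card (E `` {v})) \<le> real ((r + card S + a) * card T)"
    by (simp only: of_nat_le_iff)
  have "index V E * (index V E + 1 - (real n - real (card T))) \<le> real ((r + card S + a) * card T)"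
    using eigenvalue_le_order_minus_card[OF sub(3)] degs cV by simp
  from large_T_numeric[OF num T st stn k this] show False .
qed

text \<open>For eigenvectors \<open>x\<close> of \<open>E\<close> and \<open>z\<close> of \<open>F\<close>, the difference of the eigenvalues times the inner product of
  \<open>x\<close> and \<open>z\<close> is a sum over the arcs on which \<open>E\<close> and \<open>F\<close> differ. Placing \<open>S\<close> and \<open>Y\<close> on the largest
  entries of \<open>x\<close>, and \<open>w\<close> on the largest entry within \<open>T\<close>, makes it positive: the arcs moved to \<open>w\<close>
  gain because \<open>z w\<close> exceeds the other entries of \<open>z\<close> on \<open>T\<close> by about \<open>(a - 1) / n\<close>, whereas the
  entries on the clique vary by about \<open>1 / n\<close>, which matters only after multiplication by entries
  on \<open>T\<close>.\<close>

lemma index_less_F_graph: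
  fixes a b r n :: nat
  assumes num: "1 \<le> r" "r + 2 \<le> a" "a \<le> b" "2 * (4 * b + a + r + 2) * (b + r + 2) \<le> n"
    and G: "simple_graph V E" and cV: "card V = n"
    and T: "T \<subseteq> V" "card T = b + 1" and I: "I \<subseteq> V - T" "card I = r"
    and E_core: "\<And>u v. u \<in> V - T \<Longrightarrow> v \<in> V - T \<Longrightarrow> (u, v) \<in> E \<longleftrightarrow> (u, v) \<in> split_arcs (V - T) I"
    and e: "\<And>v. v \<in> T \<Longrightarrow> card (E `` {v} - I) = a + e v"
    and sum_e: "sum e T < a" and spread: "\<And>v. v \<in> T \<Longrightarrow> e v \<noteq> a - 1"
  shows "index V E < largest_eigenvalue (with_proj (F_graph n a b r))"
proof (rule ccontr)
  define k kF where "k = index V E" and "kF = largest_eigenvalue (with_proj (F_graph n a b r))"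
  assume "\<not> index V E < largest_eigenvalue (with_proj (F_graph n a b r))"
  then have k_ge: "kF \<le> k" by (simp add: k_def kF_def)
  note n = order_ge[OF num]
  have ne: "V \<noteq> {}" using cV n(4) by auto
  have finV: "finite V" using G by (simp add: simple_graph_def)
  have finT: "finite T" using T finV by (auto intro: finite_subset)
  have finI: "finite I" using I finV by (auto intro: finite_subset)
  note finN = simple_graph_finite_nbrs[OF G] and subN = simple_graph_nbrs_subset[OF G]
  obtain x p where x: "\<And>v. v \<in> V \<Longrightarrow> 0 \<le> x v" "\<And>v. v \<in> V \<Longrightarrow> x v \<le> 1" "p \<in> V" "x p = 1"
    "\<And>v. v \<in> V \<Longrightarrow> (\<Sum>u\<in>E `` {v}. x u) = k * x v"
    using index_eigenvector_normalized[OF G ne] unfolding k_def by metis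
  obtain w where w: "w \<in> T" and w_max: "\<And>v. v \<in> T \<Longrightarrow> x v \<le> x w"
  proof -
    have "T \<noteq> {}" using T by auto
    then have "Max (x ` T) \<in> x ` T" using finT by (intro Max_in) auto
    then obtain w where "w \<in> T" "x w = Max (x ` T)" by auto
    then show ?thesis using that[of w] finT by simp
  qed
  define A where "A = V - T - I"
  have finA: "finite A" using finV by (simp add: A_def)
  have cA: "card A = n - (b + 1) - r"
    using T I cV finT finI unfolding A_def by (simp add: card_Diff_subset)
  have aA: "a \<le> card A" using cA n(3) by linarith
  obtain S where S: "S \<subseteq> A" "card S = a" and S_top: "\<And>u v. u \<in> S \<Longrightarrow> v \<in> A - S \<Longrightarrow> x v \<le> x u"
    using obtain_top_subset[OF finA aA, of x] by blast
  have finS: "finite S" using S finA by (auto intro: finite_subset)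
  have cR: "card (A - S) = n - (a + b + r + 1)"
    using cA S finS by (simp add: card_Diff_subset)
  have aR: "a - 1 \<le> card (A - S)" using cR n(3) by linarith
  obtain Y where Y: "Y \<subseteq> A - S" "card Y = a - 1"
    and Y_top: "\<And>u v. u \<in> Y \<Longrightarrow> v \<in> A - S - Y \<Longrightarrow> x v \<le> x u"
    using obtain_top_subset[OF finite_Diff[OF finA] aR, of x] by blast
  have finY: "finite Y" using Y finA by (auto intro: finite_subset)
  interpret F_partition V I S "A - S" T Y w n a b r
    by unfold_locales (use finV T I S Y cR w in \<open>auto simp: A_def\<close>)
  define F where "F = F_arcs I S (A - S) T Y w"
  \<comment> \<open>The parts were placed according to the eigenvector \<open>x\<close> of
    \<open>E\<close>, but the eigenvalue does not depend on the placement.\<close>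
  have kF: "kF = index V F" unfolding kF_def F_def by (rule index_F_graph)
  have kF_ge: "real n - b - 9/4 \<le> kF"
    unfolding kF F_def using index_F_ge[OF n(2) cV] .
  have kF_large: "(real b + 1) * (a + r) + a + 5 * a + 2 * r \<le> kF"
  proof -
    have "real ((b + 1) * (a + r) + a + 5 * b + 5 * a + 2 * r + 10) \<le> real n"
      using n(1) by (simp only: of_nat_le_iff)
    then have "(real b + 1) * (a + r) + a + 5 * b + 5 * a + 2 * r + 10 \<le> real n" by (simp add: algebra_simps)
    then show ?thesis using kF_ge by linarith
  qed
  have ba: "0 \<le> (real b + 1) * (a + r)" by simp
  have kF_pos: "0 < kF" "5 * real a + 2 * r \<le> kF" "3 \<le> kF"
    using kF_large ba num by linarith+
  obtain z q where z: "\<And>v. v \<in> V \<Longrightarrow> 0 \<le> z v" "\<And>v. v \<in> V \<Longrightarrow> z v \<le> 1" "q \<in> V" "z q = 1"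
    "\<And>v. v \<in> V \<Longrightarrow> (\<Sum>u\<in>F `` {v}. z u) = kF * z v"
    using index_eigenvector_normalized[OF simple_graph_F ne] unfolding kF F_def by metis
  have GF: "simple_graph V F" unfolding F_def by (rule simple_graph_F)
  interpret X: normalized_eigenvector V E x p k
    by unfold_locales (use G x k_ge kF_pos in auto)
  interpret Z: normalized_eigenvector V F z q kF
    by unfold_locales (use GF z kF_pos in auto)
  \<comment> \<open>A common lower bound for the clique entries of both eigenvectors; for
    \<open>x\<close> it uses \<open>kF \<le> k\<close>.\<close>
  define m where "m = 1 - 1 / (kF + 1)"
  have m: "3/4 \<le> m" "m \<le> 1" using kF_pos unfolding m_def by (auto simp: field_simps)

  have deg: "card (E `` {v}) \<le> r + a + e v" if "v \<in> T" for v
  proof -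
    have "card (E `` {v}) = card (E `` {v} \<inter> I) + card (E `` {v} - I)"
      using finN by (rule card_Int_Diff)
    moreover have "card (E `` {v} \<inter> I) \<le> r" using I finI by (metis Int_lower2 card_mono)
    ultimately show ?thesis using e[OF that] by simp
  qed
  have e_less: "e v < a" if "v \<in> T" for v
    using member_le_sum[of v T e] that finT sum_e by simp
  have degs: "real (\<Sum>v\<in>T. card (E `` {v})) \<le> k"
  proof -
    have "(\<Sum>v\<in>T. card (E `` {v})) \<le> (\<Sum>v\<in>T. r + a + e v)" by (intro sum_mono deg)
    also have "\<dots> \<le> (b + 1) * (a + r) + a"
      using T sum_e by (simp add: sum.distrib algebra_simps)
    finally have "real (\<Sum>v\<in>T. card (E `` {v})) \<le> real ((b + 1) * (a + r) + a)"
      by (simp only: of_nat_le_iff)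
    then show ?thesis using kF_large k_ge by (simp add: algebra_simps)
  qed
  have degsF: "real (\<Sum>v\<in>T. card (F `` {v})) \<le> kF"
    unfolding F_def sum_degrees using kF_large by (simp add: algebra_simps)
  have x_A: "m \<le> x u" if "u \<in> A" for u
  proof -
    have "split_arcs (V - T) I \<subseteq> E"
      using E_core unfolding split_arcs_def by auto
    then have "1 - 1 / (k + 1) \<le> x u"
      using X.clique_entry_ge[of T I u] T degs that unfolding A_def by blast
    moreover have "1 / (k + 1) \<le> 1 / (kF + 1)" using k_ge kF_pos by (simp add: frac_le)
    ultimately show ?thesis by (simp add: m_def)
  qed
  have z_A: "m \<le> z u" if "u \<in> A" for u
  proof -
    have "split_arcs (V - T) I \<subseteq> F" unfolding F_def F_arcs_def non_T by auto
    then show ?thesis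
      using Z.clique_entry_ge[of T I u] T degsF that unfolding A_def m_def by blast
  qed
  have x_w: "kF * x w \<le> 2 * a + r"
  proof -
    have "kF * x w \<le> k * x w" using k_ge x(1) w T by (intro mult_right_mono) auto
    also have "\<dots> \<le> card (E `` {w})" using X.entry_le_degree w T by auto
    also have "\<dots> \<le> 2 * a + r" using deg[OF w] e_less[OF w] by simp
    finally show ?thesis .
  qed
  \<comment> \<open>Entries on \<open>T\<close> are at most 1/2 and hence below all clique entries.
    This matters because \<open>E\<close> may have arcs inside \<open>T\<close>: such neighbours are
    dominated by \<open>S\<close> and \<open>Y\<close> as well.\<close>
  have half: "y \<le> m" if "kF * y \<le> 2 * a + r" for y
  proof -
    have "kF * y \<le> kF * (1/2)" using that kF_pos by linarith
    then have "y \<le> 1/2" using kF_pos(1) by (rule mult_left_le_imp_le)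
    then show ?thesis using m by linarith
  qed
  have x_T: "x v \<le> m" if "v \<in> T" for v
    using half[OF x_w] w_max[OF that] by simp
  have nbrsF: "\<And>v. v \<in> T - {w} \<Longrightarrow> F `` {v} = I \<union> S" "F `` {w} = I \<union> (S \<union> Y)"
    using nbrs(1,2) by (auto simp: F_def)
  define \<zeta> where "\<zeta> = (sum z I + sum z S) / kF"
  have IS: "sum f (I \<union> S) = sum f I + sum f S" "sum f (S \<union> Y) = sum f S + sum f Y"
    "sum f (I \<union> (S \<union> Y)) = sum f I + sum f (S \<union> Y)" for f :: "'a \<Rightarrow> real"
    using finI finS finY I S Y by (auto intro!: sum.union_disjoint simp: A_def)
  have z_other: "z v = \<zeta>" if "v \<in> T - {w}" for v
    using Z.eigen[of v] that T nbrsF(1)[OF that] IS kF_pos unfolding \<zeta>_def by (auto simp: field_simps)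
  have \<zeta>: "kF * \<zeta> \<le> a + r" "0 \<le> \<zeta>"
  proof -
    have "sum z I \<le> of_nat (card I) * 1" "sum z S \<le> of_nat (card S) * 1"
      by (rule sum_bounded_above; use z(2) I S in \<open>auto simp: A_def\<close>)+
    then show "kF * \<zeta> \<le> a + r" using I S kF_pos unfolding \<zeta>_def by simp
    have "0 \<le> sum z I" "0 \<le> sum z S" using z(1) I S by (auto intro!: sum_nonneg simp: A_def)
    then show "0 \<le> \<zeta>" using kF_pos unfolding \<zeta>_def by simp
  qed
  have z_w_eq: "kF * z w = kF * \<zeta> + sum z Y"
    using Z.eigen[of w] w T nbrsF(2) IS kF_pos unfolding \<zeta>_def by auto
  have z_Y: "(real a - 1) * m \<le> sum z Y" "sum z Y \<le> real a - 1"
  proof -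
    have "of_nat (card Y) * m \<le> sum z Y"
      by (rule sum_bounded_below) (use z_A Y in auto)
    then show "(real a - 1) * m \<le> sum z Y" using Y num by (simp add: of_nat_diff)
    have "sum z Y \<le> of_nat (card Y) * 1"
      by (rule sum_bounded_above) (use z(2) Y in \<open>auto simp: A_def\<close>)
    then show "sum z Y \<le> real a - 1" using Y num by (simp add: of_nat_diff)
  qed
  have z_w: "kF * z w \<le> 2 * a + r" using z_w_eq \<zeta> z_Y by simp
  have z_T: "z v \<le> m" if "v \<in> T" for v
  proof (cases "v = w")
    case True
    then show ?thesis using half[OF z_w] by simp
  next
    case False
    then show ?thesis using half[of \<zeta>] \<zeta> z_other[of v] that by simp
  qed
  \<comment> \<open>Neighbourhoods of vertices in \<open>S\<close>, \<open>Y\<close> and the rest of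
    the clique differ only in their share of \<open>T\<close>: all of it, \<open>w\<close> alone,
    nothing. So \<open>z\<close> decreases in this order, and the sets chosen to be on top for
    \<open>x\<close> are on top for \<open>z\<close> too.\<close>
  have zS: "(kF + 1) * z u = sum z (V - T) + sum z T" if "u \<in> S" for u
  proof -
    have u: "u \<in> V - T" using that S by (auto simp: A_def)
    have "sum z (F `` {u}) = sum z (V - T - {u}) + sum z T"
      unfolding F_def nbrs(3)[OF that] by (rule sum.union_disjoint) (use finV finT w in auto)
    then have "kF * z u = sum z (V - T - {u}) + sum z T" using Z.eigen[of u] u by simp
    then show ?thesis using u finV by (simp add: sum_diff1 algebra_simps)
  qed
  have zY: "(kF + 1) * z u = sum z (V - T) + z w" if "u \<in> Y" for u
  proof -
    have u: "u \<in> V - T" using that Y by (auto simp: A_def)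
    have "sum z (F `` {u}) = sum z (V - T - {u}) + sum z {w}"
      unfolding F_def nbrs(4)[OF that] by (rule sum.union_disjoint) (use finV finT w in auto)
    then have "kF * z u = sum z (V - T - {u}) + z w" using Z.eigen[of u] u by simp
    then show ?thesis using u finV by (simp add: sum_diff1 algebra_simps)
  qed
  have zR: "(kF + 1) * z u = sum z (V - T)" if "u \<in> A - S - Y" for u
  proof -
    have u: "u \<in> V - T" using that by (auto simp: A_def)
    have "F `` {u} = V - T - {u}" unfolding F_def by (rule nbrs(5)[OF that])
    then have "kF * z u = sum z (V - T - {u})" using Z.eigen[of u] u by simp
    then show ?thesis using u finV by (simp add: sum_diff1 algebra_simps)
  qed
  have zwT: "0 \<le> z w" "z w \<le> sum z T"
    using z(1) w T finT member_le_sum[of w T z] by auto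
  have z_S_top: "z v \<le> z u" if "u \<in> S" "v \<in> A - S" for u v
  proof -
    have "(kF + 1) * z v \<le> (kF + 1) * z u"
      using zS[OF that(1)] zY[of v] zR[of v] that zwT by (cases "v \<in> Y") auto
    then show ?thesis using kF_pos by simp
  qed
  have z_Y_top: "z v \<le> z u" if "u \<in> Y" "v \<in> A - S - Y" for u v
  proof -
    have "(kF + 1) * z v \<le> (kF + 1) * z u"
      using zY[OF that(1)] zR[OF that(2)] zwT by simp
    then show ?thesis using kF_pos by simp
  qed

  have nbrs_E: "sum f (E `` {v}) \<le> sum f I + sum f (E `` {v} - I)"
    if "\<And>v. v \<in> V \<Longrightarrow> 0 \<le> f v" for f :: "'a \<Rightarrow> real" and v
  proof -
    have "sum f (E `` {v}) = sum f (E `` {v} \<inter> I) + sum f (E `` {v} - I)"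
      using finN by (rule sum.Int_Diff)
    moreover have "sum f (E `` {v} \<inter> I) \<le> sum f I"
      using that I finI by (intro sum_mono2) auto
    ultimately show ?thesis by simp
  qed
  \<comment> \<open>Stated for a generic \<open>f\<close> since it serves both eigenvectors. Trading
    the neighbours of \<open>v\<close> for \<open>I\<close> and \<open>S\<close> loses at most 1 per
    excess neighbour; trading those of \<open>w\<close> for its neighbours in \<open>F\<close> gains
    at least \<open>m\<close> per neighbour that \<open>w\<close> still lacks.\<close>
  have excess: "sum f (E `` {v}) \<le> sum f (I \<union> S) + e v"
    "sum f (E `` {w}) + (real a - 1 - e w) * m \<le> sum f (I \<union> (S \<union> Y))"
    if v: "v \<in> T" and f: "\<And>v. v \<in> V \<Longrightarrow> 0 \<le> f v" "\<And>v. v \<in> V \<Longrightarrow> f v \<le> 1"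
      "\<And>u. u \<in> A \<Longrightarrow> m \<le> f u" "\<And>u. u \<in> T \<Longrightarrow> f u \<le> m"
      "\<And>u v. u \<in> S \<Longrightarrow> v \<in> A - S \<Longrightarrow> f v \<le> f u"
      "\<And>u v. u \<in> Y \<Longrightarrow> v \<in> A - S - Y \<Longrightarrow> f v \<le> f u"
    for f :: "'a \<Rightarrow> real" and v
  proof -
    have SA: "S \<union> Y \<subseteq> A" "A \<subseteq> V" using S Y by (auto simp: A_def)
    have cases: "u \<in> A \<or> u \<in> T" if "u \<in> E `` {v} - I" for u v using that subN by (auto simp: A_def)
    have domS: "f u' \<le> f u" if "u \<in> S" "u' \<in> E `` {v} - I - S" for u u' v
      using cases[of u' v] that f(3)[of u] f(4)[of u'] f(5)[of u u'] SA by fastforce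
    have domSY: "f u' \<le> f u" if u: "u \<in> S \<union> Y" and u': "u' \<in> E `` {v} - I - (S \<union> Y)" for u u' v
    proof (cases "u' \<in> T")
      case True
      then show ?thesis using f(3)[of u] f(4)[of u'] u SA by force
    next
      case False
      then show ?thesis using cases[of u' v] u u' f(5)[of u u'] f(6)[of u u'] by auto
    qed
    have "sum f (E `` {v} - I) \<le> sum f S + (real (card (E `` {v} - I)) - real (card S))"
      by (rule sum_le_dominating_sum(1)[of _ _ f m])
        (use finN finS S num e[OF v] domS SA f in \<open>auto simp: subset_iff\<close>)
    then show "sum f (E `` {v}) \<le> sum f (I \<union> S) + e v"
      using nbrs_E[where f = f and v = v, OF f(1)] e[OF v] S IS by simp
    have cSY: "card (S \<union> Y) = a + (a - 1)"
      using finS finY S Y by (subst card_Un_disjoint) auto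
    have "sum f (E `` {w} - I) + (real (card (S \<union> Y)) - real (card (E `` {w} - I))) * m \<le> sum f (S \<union> Y)"
      by (rule sum_le_dominating_sum(2)[of _ _ f m])
        (use finN finS finY S num e[OF w] e_less[OF w] cSY domSY SA f in \<open>auto simp: subset_iff\<close>)
    moreover have "real (card (S \<union> Y)) - real (card (E `` {w} - I)) = real a - 1 - e w"
      using cSY e[OF w] num by (simp add: of_nat_diff)
    ultimately show "sum f (E `` {w}) + (real a - 1 - e w) * m \<le> sum f (I \<union> (S \<union> Y))"
      using nbrs_E[where f = f and v = w, OF f(1)] IS(3)[of f] by simp
  qed
  note excess_x = excess[where f = x, OF _ x(1,2) x_A x_T S_top Y_top]
  note excess_z = excess[where f = z, OF _ z(1,2) z_A z_T z_S_top z_Y_top]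

  \<comment> \<open>The number of excess neighbours that \<open>w\<close> lacks in comparison with
    \<open>F\<close>. It is positive by \<open>spread\<close>, and it bounds the total excess of the
    other vertices of \<open>T\<close>.\<close>
  define M where "M = real a - 1 - e w"
  have M: "1 \<le> M" using e_less[OF w] spread[OF w] num unfolding M_def by linarith
  have others: "(\<Sum>v\<in>T - {w}. real (e v)) \<le> M"
  proof -
    have "sum e T = e w + sum e (T - {w})" using finT w by (rule sum.remove)
    then have "e w + sum e (T - {w}) + 1 \<le> a" using sum_e by simp
    then have "real (e w + sum e (T - {w}) + 1) \<le> real a" by (simp only: of_nat_le_iff)
    then show ?thesis unfolding M_def by simp
  qed
  \<comment> \<open>The contribution of \<open>v\<close> to the difference of the two forms, as
    given by \<open>adjacency_form_split\<close>.\<close>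
  define g where "g v = x v * (sum z (F `` {v}) - sum z (E `` {v}))
      + z v * (sum x (F `` {v} - T) - sum x (E `` {v} - T))" for v
  have drop_T: "sum x (E `` {v} - T) \<le> sum x (E `` {v})" for v
    using finN subN x(1) by (intro sum_mono2) blast+
  have g_w: "M * m * (x w + z w) \<le> g w"
  proof -
    have "F `` {w} - T = I \<union> (S \<union> Y)" using nbrsF(2) I S Y by (auto simp: A_def)
    then have "M * m \<le> sum z (F `` {w}) - sum z (E `` {w})"
      "M * m \<le> sum x (F `` {w} - T) - sum x (E `` {w} - T)"
      using excess_x(2)[OF w] excess_z(2)[OF w] drop_T[of w] nbrsF(2) unfolding M_def by simp_all
    then have "x w * (M * m) + z w * (M * m) \<le> g w"
      unfolding g_def using x(1) z(1) w T by (intro add_mono mult_left_mono) auto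
    then show ?thesis by (simp add: algebra_simps)
  qed
  have g_other: "- (real (e v) * (x w + \<zeta>)) \<le> g v" if v: "v \<in> T - {w}" for v
  proof -
    have vT: "v \<in> T" "v \<in> V" using v T by auto
    have "F `` {v} - T = I \<union> S" using nbrsF(1)[OF v] I S by (auto simp: A_def)
    then have "- real (e v) \<le> sum z (F `` {v}) - sum z (E `` {v})"
      "- real (e v) \<le> sum x (F `` {v} - T) - sum x (E `` {v} - T)"
      using excess_x(1)[OF vT(1)] excess_z(1)[OF vT(1)] drop_T[of v] nbrsF(1)[OF v] by simp_all
    then have "x v * (- real (e v)) + z v * (- real (e v)) \<le> g v"
      unfolding g_def using x(1) z(1) vT by (intro add_mono mult_left_mono) auto
    moreover have "real (e v) * x v \<le> real (e v) * x w"
      using w_max[OF vT(1)] by (intro mult_left_mono) auto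
    ultimately show ?thesis using z_other[OF v] by (simp add: algebra_simps)
  qed
  \<comment> \<open>The gain of one arc moved to \<open>w\<close> exceeds its loss. After
    multiplication by \<open>kF\<close> the gap between \<open>z w\<close> and
    \<open>\<zeta>\<close> is \<open>sum z Y\<close>, at least \<open>(a - 1) * m\<close>; with
    \<open>a \<ge> 3\<close> and \<open>m \<ge> 3/4\<close>, another factor \<open>m\<close> still
    leaves at least 9/8. The cost of replacing \<open>m\<close> by 1 in the other terms is at most
    \<open>\<delta> * (3 * a + 2 * r)\<close>, at most 1.\<close>
  have bracket: "x w + \<zeta> < m * (x w + z w)"
  proof -
    define \<delta> where "\<delta> = 1 / (kF + 1)"
    have \<delta>: "0 \<le> \<delta>" "m = 1 - \<delta>" using kF_pos by (auto simp: \<delta>_def m_def)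
    have "\<delta> * (3 * real a + 2 * r) \<le> 1"
      unfolding \<delta>_def using kF_pos by (simp add: field_simps)
    moreover have "\<delta> * (kF * x w) \<le> \<delta> * (2 * real a + r)" "\<delta> * (kF * \<zeta>) \<le> \<delta> * (real a + r)"
      using \<delta> x_w \<zeta> by (auto intro!: mult_left_mono)
    moreover have "1 < (real a - 1) * m * m"
    proof -
      have "2 * (3/4) * (3/4) \<le> (real a - 1) * m * m"
        using m num by (intro mult_mono) auto
      then show ?thesis by simp
    qed
    moreover have "m * ((real a - 1) * m) \<le> m * sum z Y" using m z_Y by (intro mult_left_mono) auto
    moreover have "kF * (m * (x w + z w)) - kF * (x w + \<zeta>)
        = m * (kF * z w - kF * \<zeta>) - \<delta> * (kF * x w) - \<delta> * (kF * \<zeta>)"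
      unfolding \<delta>(2) by (simp add: algebra_simps)
    ultimately have "0 < kF * (m * (x w + z w)) - kF * (x w + \<zeta>)"
      using z_w_eq by (simp add: algebra_simps)
    then show ?thesis using kF_pos by simp
  qed
  have "0 < M * m * (x w + z w) - M * (x w + \<zeta>)"
    using mult_strict_left_mono[OF bracket, of M] M by (simp add: algebra_simps)
  also have "\<dots> \<le> M * m * (x w + z w) - (\<Sum>v\<in>T - {w}. real (e v)) * (x w + \<zeta>)"
    using others x(1)[of w] \<zeta>(2) w T by (intro diff_left_mono mult_right_mono) auto
  also have "\<dots> = M * m * (x w + z w) + (\<Sum>v\<in>T - {w}. - (real (e v) * (x w + \<zeta>)))"
    by (simp add: sum_negf sum_distrib_right)
  also have "\<dots> \<le> g w + (\<Sum>v\<in>T - {w}. g v)"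
    using g_w g_other by (intro add_mono sum_mono) auto
  also have "\<dots> = sum g T" using finT w by (simp add: sum.remove)
  also have "\<dots> = adjacency_form F x z - adjacency_form E x z"
  proof -
    have "adjacency_form F x z = adjacency_form (split_arcs (V - T) I) x z
        + (\<Sum>v\<in>T. x v * (\<Sum>u\<in>F `` {v}. z u) + z v * (\<Sum>u\<in>F `` {v} - T. x u))"
      by (rule adjacency_form_split[OF GF T(1)]) (unfold F_def, rule F_partition.core[OF F_partition_axioms])
    moreover have "adjacency_form E x z = adjacency_form (split_arcs (V - T) I) x z
        + (\<Sum>v\<in>T. x v * (\<Sum>u\<in>E `` {v}. z u) + z v * (\<Sum>u\<in>E `` {v} - T. x u))"
      by (rule adjacency_form_split[OF G T(1) E_core])
    ultimately show ?thesis
      by (simp add: g_def sum_subtractf[symmetric] algebra_simps)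
  qed
  also have "adjacency_form F x z = kF * (\<Sum>v\<in>V. x v * z v)"
    by (rule adjacency_form_eigen[OF GF Z.eigen])
  also have "adjacency_form E x z = k * (\<Sum>v\<in>V. x v * z v)"
    using adjacency_form_commute[of E x z] G adjacency_form_eigen[OF G X.eigen, of z]
    by (simp add: simple_graph_def mult.commute)
  finally have "k * (\<Sum>v\<in>V. x v * z v) < kF * (\<Sum>v\<in>V. x v * z v)" by simp
  moreover have "0 \<le> (\<Sum>v\<in>V. x v * z v)" using x z by (intro sum_nonneg) auto
  ultimately show False using k_ge by (meson leD mult_right_mono)
qed

section \<open>The main theorem\<close>

text \<open>Needed when only the eigenvalue of \<open>F\<close> matters, so that any placement of
  its parts serves.\<close>

lemma F_partition_exists:
  assumes "finite V" "card V = n" "2 * a + b + r + 1 \<le> n"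
  shows "\<exists>I S R T Y w. F_partition V I S R T Y w n a b r"
proof -
  obtain T where T: "T \<subseteq> V" "card T = b + 1"
    using obtain_subset_with_card_n[of "b + 1" V] assms by auto
  then have fT: "finite T" using assms by (auto intro: finite_subset)
  have cT: "card (V - T) = n - (b + 1)" using T fT assms by (simp add: card_Diff_subset)
  have "r \<le> card (V - T)" using cT assms(3) by linarith
  then obtain I where I: "I \<subseteq> V - T" "card I = r"
    by (metis obtain_subset_with_card_n)
  then have fI: "finite I" using assms by (auto intro: finite_subset)
  have cI: "card (V - T - I) = n - (b + 1) - r" using I fI cT by (simp add: card_Diff_subset)
  have "a \<le> card (V - T - I)" using cI assms(3) by linarith
  then obtain S where S: "S \<subseteq> V - T - I" "card S = a"
    by (metis obtain_subset_with_card_n)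
  then have fS: "finite S" using assms by (auto intro: finite_subset)
  define R where "R = V - T - I - S"
  have cR: "card R = n - (a + b + r + 1)" using S fS cI by (simp add: R_def card_Diff_subset)
  have "a - 1 \<le> card R" using cR assms(3) by linarith
  then obtain Y where Y: "Y \<subseteq> R" "card Y = a - 1"
    by (metis obtain_subset_with_card_n)
  obtain w where w: "w \<in> T" using T by fastforce
  have "F_partition V I S R T Y w n a b r"
    by unfold_locales (use assms T I S Y w cR in \<open>auto simp: R_def\<close>)
  then show ?thesis by blast
qed

text \<open>If \<open>|S| \<ge> a\<close>, the term \<open>b * |S|\<close> alone gives the bound.
  Otherwise each vertex of \<open>T\<close> keeps at least \<open>a - |S|\<close> neighbours off
  \<open>I\<close> and \<open>S\<close>, and the obstruction reduces to
  \<open>b * |S| < |S| * |T|\<close>.\<close>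

lemma obstruction_card_gt:
  fixes a b r :: nat
  assumes G: "simple_graph V E" and sub: "S \<subseteq> V" "I \<subseteq> V" and cI: "card I = r"
    and T: "T \<subseteq> V" and deg: "\<And>v. v \<in> T \<Longrightarrow> a + r \<le> card (E `` {v})" and "a \<le> b"
    and obstr: "b * card S + (\<Sum>v\<in>T. card (E `` {v} - I - S)) < a * card T"
  shows "b < card T"
proof (cases "a \<le> card S")
  case True
  have "a * b \<le> b * card S" using True by (simp add: mult.commute)
  then have "a * b < a * card T" using obstr by linarith
  then show ?thesis by simp
next
  case False
  have "a - card S \<le> card (E `` {v} - I - S)" if "v \<in> T" for v
  proof -
    have fin: "finite I" "finite S" using G sub unfolding simple_graph_def by (auto intro: finite_subset)
    have "card (E `` {v}) - card I \<le> card (E `` {v} - I)" using fin(1) by (rule diff_card_le_card_Diff)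
    moreover have "card (E `` {v} - I) - card S \<le> card (E `` {v} - I - S)"
      using fin(2) by (rule diff_card_le_card_Diff)
    ultimately show ?thesis using deg[OF that] cI by linarith
  qed
  then have "card T * (a - card S) \<le> (\<Sum>v\<in>T. card (E `` {v} - I - S))"
    using sum_bounded_below[of T "a - card S" "\<lambda>v. card (E `` {v} - I - S)"] by simp
  moreover have "card T * (a - card S) + card S * card T = a * card T"
    using False by (simp add: algebra_simps flip: distrib_left)
  ultimately have "card S * b < card S * card T" using obstr mult.commute[of b "card S"] by linarith
  then show ?thesis by simp
qed

text \<open>The obstruction makes the total excess smaller than \<open>|S|\<close>, and
  \<open>|S| \<le> a\<close>. An excess of \<open>a - 1\<close> at \<open>w\<close> therefore
  exhausts everything: \<open>|S| = a\<close>, no excess elsewhere on \<open>T\<close>, and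
  \<open>T\<close> completely joined to \<open>S\<close>.\<close>

lemma extremal_subgraph:
  fixes a b r n :: nat
  assumes G: "simple_graph V E" and cV: "card V = n" and n: "a + b + r + 1 \<le> n" and ab: "1 \<le> a" "a \<le> b"
    and T: "T \<subseteq> V" "card T = b + 1" and I: "I \<subseteq> V - T" "card I = r"
    and S: "S \<subseteq> V - T - I"
    and indep: "\<And>u v. u \<in> I \<Longrightarrow> v \<in> I \<Longrightarrow> (u, v) \<notin> E"
    and obstr: "b * card S + (\<Sum>v\<in>T. card (E `` {v} - I - S)) < a * card T"
    and e: "\<And>v. v \<in> T \<Longrightarrow> card (E `` {v} - I) = a + e v"
    and w: "w \<in> T" "e w = a - 1"
  obtains R Y where "F_partition V I S R T Y w n a b r" "E \<subseteq> F_arcs I S R T Y w"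
proof -
  have fin: "finite V" "E \<subseteq> V \<times> V" and sym: "\<And>u v. (u, v) \<in> E \<longleftrightarrow> (v, u) \<in> E"
    and irr: "\<And>u. (u, u) \<notin> E"
    using G unfolding simple_graph_def sym_def irrefl_def by auto
  have fins: "finite T" "finite I" "finite S" using fin T I S by (auto intro: finite_subset)
  note finN = simple_graph_finite_nbrs[OF G]
  have split: "card (E `` {v} - I) = card (E `` {v} \<inter> S) + card (E `` {v} - I - S)" for v
  proof -
    have "(E `` {v} - I) \<inter> S = E `` {v} \<inter> S" using S by auto
    then show ?thesis using card_Int_Diff[of "E `` {v} - I" S] finN by simp
  qed
  have le_S: "card (E `` {v} \<inter> S) \<le> card S" for v using fins by (simp add: card_mono)
  have "b * card S < a * (b + 1)" using obstr unfolding T(2) by linarith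
  also have "\<dots> \<le> b * (a + 1)" using ab by (simp add: algebra_simps)
  finally have "card S < a + 1" by (simp only: mult_less_cancel1)
  then have s_le: "card S \<le> a" by simp
  have total: "(\<Sum>v\<in>T. card (E `` {v} - I)) = (b + 1) * a + sum e T"
    using e T by (simp add: sum.distrib)
  have total_split: "(\<Sum>v\<in>T. card (E `` {v} - I))
      = (\<Sum>v\<in>T. card (E `` {v} \<inter> S)) + (\<Sum>v\<in>T. card (E `` {v} - I - S))"
    by (simp add: split sum.distrib)
  have S_sum: "(\<Sum>v\<in>T. card (E `` {v} \<inter> S)) \<le> (b + 1) * card S"
    using sum_bounded_above[of T "\<lambda>v. card (E `` {v} \<inter> S)" "card S"] le_S T by simp
  have sum_e: "sum e T = e w + sum e (T - {w})" using fins w by (simp add: sum.remove)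
  have expand: "(b + 1) * card S = b * card S + card S" "(b + 1) * a = a * b + a" "a * card T = a * b + a"
    using T by (simp_all add: algebra_simps)
  have S_a: "card S = a" and rest: "sum e (T - {w}) = 0"
    using total total_split S_sum sum_e w obstr s_le expand ab by linarith+
  \<comment> \<open>Strictness of the obstruction is worth exactly one arc: the count of arcs from
    \<open>T\<close> to \<open>S\<close> exceeds \<open>(b + 1) * a - 1\<close>, so it is the
    maximum possible.\<close>
  have "(\<Sum>v\<in>T. card S) \<le> (\<Sum>v\<in>T. card (E `` {v} \<inter> S))"
    using total total_split sum_e rest w obstr expand S_a T by (simp add: algebra_simps)
  then have "card (E `` {v} \<inter> S) = card S" if "v \<in> T" for v
    using sum_mono_inv[of "\<lambda>v. card (E `` {v} \<inter> S)" T "\<lambda>_. card S" v] le_S fins that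
      sum_mono[of T "\<lambda>v. card (E `` {v} \<inter> S)" "\<lambda>_. card S"] by (metis le_antisym)
  then have S_sub: "S \<subseteq> E `` {v}" if "v \<in> T" for v
    using that fins by (metis Int_lower1 Int_lower2 card_subset_eq)
  have nb_other: "E `` {v} - I = S" if v: "v \<in> T - {w}" for v
  proof -
    have "e v = 0" using rest v fins by simp
    then have "card (E `` {v} - I) = card S" using e[of v] v S_a by simp
    moreover have "S \<subseteq> E `` {v} - I" using S_sub v S by auto
    ultimately show ?thesis using finN by (metis card_subset_eq finite_Diff)
  qed
  define R Y where "R = V - T - I - S" and "Y = E `` {w} - I - S"
  have cY: "card Y = a - 1"
    using split[of w] S_sub[OF w(1)] e[OF w(1)] w S_a unfolding Y_def by (simp add: Int_absorb1)
  have YR: "Y \<subseteq> R"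
  proof
    fix y assume y: "y \<in> Y"
    \<comment> \<open>A neighbour of \<open>w\<close> inside \<open>T\<close> would have
      \<open>w\<close> as a neighbour off \<open>I\<close>, but the other vertices of
      \<open>T\<close> have only \<open>S\<close> there.\<close>
    have "y \<notin> T"
    proof
      assume "y \<in> T"
      moreover have "y \<noteq> w" using y irr unfolding Y_def by auto
      ultimately have "E `` {y} - I = S" by (intro nb_other) auto
      moreover have "w \<in> E `` {y} - I" using y sym w I unfolding Y_def by auto
      ultimately show False using w S by auto
    qed
    then show "y \<in> R" using y fin unfolding Y_def R_def by auto
  qed
  have "card R = n - (a + b + r + 1)"
  proof -
    have "T \<inter> I = {}" "(T \<union> I) \<inter> S = {}" using I S by auto
    then have "card (T \<union> I \<union> S) = b + 1 + r + a"
      using fins T I S_a by (simp add: card_Un_disjoint)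
    moreover have "R = V - (T \<union> I \<union> S)" unfolding R_def by auto
    moreover have "T \<union> I \<union> S \<subseteq> V" using T I S by auto
    ultimately show ?thesis using cV fins by (simp add: card_Diff_subset)
  qed
  then have part: "F_partition V I S R T Y w n a b r"
    by unfold_locales (use fin T I S S_a w YR cY in \<open>auto simp: R_def\<close>)
  have nbT: "u \<in> I \<union> S \<or> v = w \<and> u \<in> Y" if "(v, u) \<in> E" "v \<in> T" for u v
  proof (cases "v = w")
    case True
    then show ?thesis using that unfolding Y_def by auto
  next
    case False
    then show ?thesis using nb_other[of v] that by auto
  qed
  have "E \<subseteq> F_arcs I S R T Y w"
  proof
    fix p assume p: "p \<in> E"
    obtain u v where uv: "p = (u, v)" by (cases p)
    have uvV: "u \<in> V" "v \<in> V" and ne: "u \<noteq> v" using p uv fin irr by auto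
    consider "u \<in> T" | "v \<in> T" | "u \<notin> T" "v \<notin> T" by blast
    then show "p \<in> F_arcs I S R T Y w"
    proof cases
      case 1
      then show ?thesis using nbT[of u v] p uv unfolding F_arcs_def by auto
    next
      case 2
      then show ?thesis using nbT[of v u] p uv sym unfolding F_arcs_def by auto
    next
      case 3
      then have "u \<in> I \<union> S \<union> R" "v \<in> I \<union> S \<union> R" using uvV unfolding R_def by auto
      then show ?thesis using ne indep p uv unfolding F_arcs_def split_arcs_def by auto
    qed
  qed
  then show ?thesis using that part by blast
qed

section \<open>From pair graphs to sets of arcs\<close>

lemma pair_graph_simple_graph:
  assumes "pair_graph G"
  shows "simple_graph (pverts G) (parcs G)"
proof -
  interpret pair_graph G by fact
  show ?thesis
    unfolding simple_graph_def
    using pair_finite_verts in_arcsD1 in_arcsD2 arcs_symmetric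
    by (auto simp: sym_def irrefl_def dest: no_loops')
qed

text \<open>Connectedness is defined through the symmetric closure, which for a pair graph is the
  graph itself.\<close>

lemma connected_rtrancl:
  assumes "pair_graph G" "Digraph_Component.connected (with_proj G)" "u \<in> pverts G" "v \<in> pverts G"
  shows "(u, v) \<in> (parcs G)\<^sup>*"
proof -
  interpret pair_graph G by fact
  have "parcs (mk_symmetric (with_proj G)) = parcs G"
    unfolding mk_symmetric_def using arcs_symmetric by auto
  moreover have "u \<rightarrow>\<^sup>*\<^bsub>with_proj (mk_symmetric (with_proj G))\<^esub> v"
    using assms unfolding Digraph_Component.connected_def strongly_connected_def
    by (simp add: mk_symmetric_def)
  ultimately show ?thesis
    unfolding reachable_def by (simp add: rtrancl_on_def[symmetric]) (metis rtrancl_on_rtranclI)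
qed

lemma min_degree_le_card_nbrs:
  assumes "pair_graph G" "v \<in> pverts G"
  shows "min_degree (with_proj G) \<le> card (parcs G `` {v})"
proof -
  interpret pair_graph G by fact
  have "out_arcs (with_proj G) v = Pair v ` (parcs G `` {v})"
    unfolding out_arcs_def by auto
  then have "out_degree (with_proj G) v = card (parcs G `` {v})"
    unfolding out_degree_def by (simp add: card_image inj_on_def)
  moreover have "min_degree (with_proj G) \<le> out_degree (with_proj G) v"
    unfolding min_degree_def using assms(2) pair_finite_verts by (intro Min_le) auto
  ultimately show ?thesis by simp
qed

theorem theorem1p8:
  fixes G :: "'a pair_pre_digraph" and n a b r :: nat
  assumes "1 \<le> r" and "r + 2 \<le> a" and "a \<le> b"
    and "pair_graph G"
    and "Digraph_Component.connected (with_proj G)"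
    and "card (pverts G) = n"
    and "2 * (4 * b + a + r + 2) * (b + r + 2) \<le> n"
    and "a + r \<le> min_degree (with_proj G)"
    and "largest_eigenvalue (with_proj (F_graph n a b r)) \<le> largest_eigenvalue (with_proj G)"
  shows "fractional_ID_factor_critical a b r (with_proj G)
    \<or> digraph_iso (with_proj G) (with_proj (F_graph n a b r))"
proof (rule disjCI)
  assume not_iso: "\<not> digraph_iso (with_proj G) (with_proj (F_graph n a b r))"
  show "fractional_ID_factor_critical a b r (with_proj G)"
  proof (rule ccontr)
    assume "\<not> fractional_ID_factor_critical a b r (with_proj G)"
    then obtain I where indep: "independent_set (with_proj G) I" and cI: "card I = r"
      and no: "\<not> has_fractional_factor a b (with_proj G \<restriction> (pverts G - I))"
      unfolding fractional_ID_factor_critical_def by auto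
    define V E where "V = pverts G" and "E = parcs G"
    have G: "simple_graph V E" unfolding V_def E_def by (rule pair_graph_simple_graph) fact
    have fin: "finite V" "E \<subseteq> V \<times> V" and irr: "\<And>u. (u, u) \<notin> E"
      and sym: "\<And>u v. (u, v) \<in> E \<Longrightarrow> (v, u) \<in> E"
      using G unfolding simple_graph_def irrefl_def sym_def by auto
    note num = assms(1-3,7)
    note n = order_ge[OF num]
    have cV: "card V = n" using assms(6) by (simp add: V_def)
    have ne: "V \<noteq> {}" using cV n(4) by auto
    have idx: "index V E = largest_eigenvalue (with_proj G)"
      by (simp add: index_def V_def E_def pair_pre_digraph_eta)
    have I: "I \<subseteq> V" "\<And>u v. u \<in> I \<Longrightarrow> v \<in> I \<Longrightarrow> (u, v) \<notin> E"
      using indep unfolding independent_set_def V_def E_def by auto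
    let ?H = "with_proj G \<restriction> (pverts G - I)"
    have H: "verts ?H = V - I" "arcs_ends ?H = E \<inter> (V - I) \<times> (V - I)"
      unfolding induce_subgraph_def V_def E_def
      by (auto simp: arcs_ends_def arc_to_ends_def image_iff)
    have GH: "simple_graph (verts ?H) (arcs_ends ?H)"
      unfolding H simple_graph_def using fin sym irr by (auto simp: sym_def irrefl_def)
    obtain S T where ST: "S \<subseteq> V - I" "T \<subseteq> V - I" "S \<inter> T = {}"
      and obstr_H: "b * card S + (\<Sum>v\<in>T. card (arcs_ends ?H `` {v} - S)) < a * card T"
      by (rule no_fractional_factor_obstruction[OF GH assms(3) no, unfolded H(1)])
    have "arcs_ends ?H `` {v} - S = E `` {v} - I - S" if "v \<in> T" for v
      unfolding H using ST that fin by auto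
    then have obstr: "b * card S + (\<Sum>v\<in>T. card (E `` {v} - I - S)) < a * card T"
      using obstr_H by simp
    have deg: "a + r \<le> card (E `` {v})" if "v \<in> V" for v
      using min_degree_le_card_nbrs[OF assms(4), of v] that assms(8) by (simp add: V_def E_def)
    have sub: "S \<subseteq> V" "T \<subseteq> V" "I \<inter> S = {}" "I \<inter> T = {}" using ST by auto
    have bT: "b < card T"
      using obstruction_card_gt[OF G sub(1) I(1) cI sub(2) _ assms(3) obstr] deg sub by auto
    show False
    proof (cases "card T = b + 1")
      case False
      obtain I' S' R' T' Y' w' where "F_partition V I' S' R' T' Y' w' n a b r"
        using F_partition_exists[OF fin(1) cV n(3)] by blast
      then interpret F: F_partition V I' S' R' T' Y' w' n a b r .
      have "index V E < real n - b - 9/4"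
        by (rule index_less_of_large_T[OF num G cV I(1) sub(1-4) ST(3) cI _ obstr]) (use False bT in simp)
      also have "\<dots> \<le> largest_eigenvalue (with_proj (F_graph n a b r))"
        unfolding F.index_F_graph by (rule F.index_F_ge[OF n(2) cV])
      finally show False using assms(9) idx by simp
    next
      case True
      have fins: "finite I" "finite S" "finite T" using I sub fin by (auto intro: finite_subset)
      \<comment> \<open>The subtraction is never truncated on \<open>T\<close>: the minimum degree
        is at least \<open>a + r\<close>, and deleting \<open>I\<close> costs at most
        \<open>r\<close>.\<close>
      define e where "e v = card (E `` {v} - I) - a" for v
      have e: "card (E `` {v} - I) = a + e v" if "v \<in> T" for v
      proof -
        have "card (E `` {v}) - card I \<le> card (E `` {v} - I)" using fins(1) by (rule diff_card_le_card_Diff)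
        then show ?thesis using deg[of v] that sub cI unfolding e_def by auto
      qed
      show False
      proof (cases "\<exists>w\<in>T. e w = a - 1")
        case True
        then obtain w where w: "w \<in> T" "e w = a - 1" by blast
        obtain R Y where part: "F_partition V I S R T Y w n a b r" and E_sub: "E \<subseteq> F_arcs I S R T Y w"
          by (rule extremal_subgraph[OF G cV _ _ assms(3) sub(2) \<open>card T = b + 1\<close> _ cI _ I(2) obstr e w])
            (use n(3) num I sub ST in auto)
        interpret F: F_partition V I S R T Y w n a b r by (rule part)
        have E_eq: "E = F_arcs I S R T Y w"
          by (rule index_strict_mono[OF G F.simple_graph_F E_sub ne])
            (use connected_rtrancl[OF assms(4,5)] assms(9) idx F.index_F_graph in \<open>auto simp: V_def E_def\<close>)
        have "digraph_iso (with_proj G) (with_proj (F_graph n a b r))"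
          using F.digraph_iso_F_graph unfolding E_eq[symmetric] unfolding V_def E_def pair_pre_digraph_eta .
        then show False using not_iso by simp
      next
        case spread: False
        \<comment> \<open>Arcs meeting \<open>T\<close> are unchanged, so the excesses
          \<open>e\<close> survive, while the rest becomes the split graph that \<open>F\<close>
          also has off \<open>T\<close>. Only a bound on the total excess is carried over from the
          obstruction.\<close>
        define E' where "E' = split_arcs (V - T) I \<union> (E - (V - T) \<times> (V - T))"
        have G': "simple_graph V E'"
          unfolding simple_graph_def E'_def split_arcs_def
          using fin sym irr by (auto simp: sym_def irrefl_def)
        have "E \<subseteq> E'" using irr I(2) unfolding E'_def split_arcs_def by auto
        then have "index V E \<le> index V E'" by (rule index_mono[OF G G' _ ne])
        have nbT: "E' `` {v} = E `` {v}" if "v \<in> T" for v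
          unfolding E'_def split_arcs_def using that by auto
        have "b * card S < a * (b + 1)" using obstr unfolding True by linarith
        also have "\<dots> \<le> b * (a + 1)" using assms(3) by (simp add: algebra_simps)
        finally have "card S < a + 1" by (simp only: mult_less_cancel1)
  then have s_le: "card S \<le> a" by simp
        \<comment> \<open>Together with the obstruction this gives \<open>sum e T < |S|\<close>, and
          \<open>|S| \<le> a\<close>.\<close>
        have "(\<Sum>v\<in>T. a + e v) \<le> (\<Sum>v\<in>T. card S + card (E `` {v} - I - S))"
        proof (rule sum_mono)
          fix v assume "v \<in> T"
          have "card (E `` {v} - I) - card S \<le> card (E `` {v} - I - S)"
            using fins(2) by (rule diff_card_le_card_Diff)
          then show "a + e v \<le> card S + card (E `` {v} - I - S)" using e[OF \<open>v \<in> T\<close>] by simp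
        qed
        then have "sum e T < a"
          using obstr s_le True by (simp add: sum.distrib algebra_simps)
        then have "index V E' < largest_eigenvalue (with_proj (F_graph n a b r))"
          by (intro index_less_F_graph[OF num G' cV sub(2) True, where I = I and e = e])
            (use I sub cI nbT e spread in \<open>auto simp: E'_def\<close>)
        then show False using \<open>index V E \<le> index V E'\<close> assms(9) idx by simp
      qed
    qed
  qed
qed

end
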